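(* Up to a global phase factor and a local change of basis, the coarse-grained scalar quantum walks with coordination number two on the infinite dihedral group $D_\infty$ are exactly the walks with symbol $$A_k=e^{i\theta\sigma_x}A_k^De^{i\theta'\sigma_x},\qquad A_k^D=\begin{pmatrix}\nu e^{-ik}&is\mu\\ is\mu&\nu e^{ik}\end{pmatrix},$$ with $\theta,\theta'\in(-\pi/2,0)\cup(0,\pi/2)$, $\nu\in(0,1]$, $\mu\in[0,1)$, $\nu^2+\mu^2=1$, $s\in\{+1,-1\}$ and $\sigma_x=\begin{pmatrix}0&1\\1&0\end{pmatrix}$. That is, the set $\mathcal{W}_{CG}$ of such coarse-grained walks (taken up to local change of basis) equals the set of walks with symbol $e^{i\eta}\,U e^{i\theta\sigma_x}A_k^De^{i\theta'\sigma_x}U^\dagger$, where $\eta\in\mathbb{R}$, $U$ is a $k$-independent unitary $2\times 2$ matrix, $\theta,\theta'\in(-\pi/2,0)\cup(0,\pi/2)$, $\nu\in(0,1]$, $\mu\in[0,1)$, $\nu^2+\mu^2=1$ and $s\in\{+1,-1\}$.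
   Context: For a discrete group $G$, $T$ denotes the right regular representation on $\ell^2(G)$, $T_g|x\rangle=|xg^{-1}\rangle$. Scalar quantum walk. A scalar quantum walk on $G$ is a unitary operator on $\ell^2(G)$ of the form $A=\sum_{h\in S_+}z_hT_h$, where $S_+\subseteq G$ is a finite generating set of $G$ (every element of $G$ is a product of elements of $S_+$ and their inverses; $S_+$ need not be symmetric and may contain the identity $e$) and all $z_h\in\mathbb{C}\setminus\{0\}$. Coarse-graining. Let $D_\infty=\langle a,r\mid r^2,\ rar^{-1}a\rangle=\mathbb{Z}\rtimes\mathbb{Z}_2$, $H=\langle a\rangle\cong\mathbb{Z}$, and choose coset representatives $c_1\in H$, $c_2\in Hr$, so that $D_\infty=Hc_1\cup Hc_2$. Let $U_H:\ell^2(D_\infty)\to\ell^2(H)\otimes\mathbb{C}^2$ be the unitary $U_H|xc_j\rangle=|x\rangle|j\rangle$ for $x\in H$, $j=1,2$, with $\{|1\rangle,|2\rangle\}$ the canonical basis of $\mathbb{C}^2$. For a scalar quantum walk $A=\sum_{h\in S_+}z_hT_h$ on $D_\infty$ its coarse-graining is $$\mathcal{R}[A]=U_HAU_H^\dagger=\sum_{h\in S_+}\sum_{j=1,2}z_h\,T_{c_{\tau(h,j)}hc_j^{-1}}\otimes|\tau(h,j)\rangle\langle j|,$$ where $\tau(h,j)\in\{1,2\}$ is the index with $c_jh^{-1}\in Hc_{\tau(h,j)}$, and $T$ on the right-hand side is the right regular representation of $H$. The coarse-grained walk has coordination number two if all elements $c_{\tau(h,j)}hc_j^{-1}$ ($h\in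 S_+$, $j=1,2$) lie in $\{e,a,a^{-1}\}$. In that case $\mathcal{R}[A]=T_a\otimes A_++T_{a^{-1}}\otimes A_-+T_e\otimes A_e$ for $2\times2$ matrices $A_\pm,A_e$, and its symbol is $A_k=e^{-ik}A_++e^{ik}A_-+A_e$, $k\in[-\pi,\pi]$; the walk is identified with its symbol. $\mathcal{W}_{CG}$ is the set of all walks with symbol $UA_kU^\dagger$, where $U$ is a $k$-independent unitary $2\times2$ matrix (local change of basis) and $A_k$ is the symbol of a coarse-graining $\mathcal{R}[A]$ with coordination number two of some scalar quantum walk $A$ on $D_\infty$ (for some finite generating set and some choice of coset representatives). *)

theory Defs
  imports "HOL-Analysis.Analysis" "HOL-Algebra.Coset" "HOL-Algebra.Generated_Groups"
begin

section \<open>Square-summable functions, unitary operators\<close>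

text \<open>Vectors of \<open>\<ell>\<^sup>2(X)\<close> are functions on the ambient type that vanish outside \<open>X\<close>; operators are
  HOL functions of which only the action on \<open>\<ell>\<^sup>2(X)\<close> matters.\<close>

definition ell2 :: "'a set \<Rightarrow> ('a \<Rightarrow> complex) set" where
  "ell2 X = {\<psi>. (\<forall>x. x \<notin> X \<longrightarrow> \<psi> x = 0) \<and> (\<lambda>x. (cmod (\<psi> x))\<^sup>2) summable_on X}"

definition ell2_inner :: "'a set \<Rightarrow> ('a \<Rightarrow> complex) \<Rightarrow> ('a \<Rightarrow> complex) \<Rightarrow> complex" where
  "ell2_inner X \<phi> \<psi> = (\<Sum>\<^sub>\<infinity>x\<in>X. cnj (\<phi> x) * \<psi> x)"

definition unitary_on_ell2 :: "'a set \<Rightarrow> (('a \<Rightarrow> complex) \<Rightarrow> ('a \<Rightarrow> complex)) \<Rightarrow> bool" where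
  "unitary_on_ell2 X A \<longleftrightarrow>
     (\<forall>\<phi>\<in>ell2 X. \<forall>\<psi>\<in>ell2 X. \<forall>a b. A (\<lambda>x. a * \<phi> x + b * \<psi> x) = (\<lambda>x. a * A \<phi> x + b * A \<psi> x)) \<and>
     A ` ell2 X = ell2 X \<and>
     (\<forall>\<phi>\<in>ell2 X. \<forall>\<psi>\<in>ell2 X. ell2_inner X (A \<phi>) (A \<psi>) = ell2_inner X \<phi> \<psi>)"

definition ket :: "'a \<Rightarrow> 'a \<Rightarrow> complex" where
  "ket x = (\<lambda>y. if y = x then 1 else 0)"


section \<open>Scalar quantum walks\<close>

text \<open>Since \<open>T\<^sub>g |x\<rangle> = |x g\<^sup>-\<^sup>1\<rangle>\<close>, the function \<open>T\<^sub>g \<psi>\<close> takes the value \<open>\<psi> (x g)\<close> at \<open>x\<close>;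
  see \<open>right_reg_ket\<close>.\<close>

definition right_reg :: "('g, 'm) monoid_scheme \<Rightarrow> 'g \<Rightarrow> ('g \<Rightarrow> complex) \<Rightarrow> ('g \<Rightarrow> complex)" where
  "right_reg G g \<psi> = (\<lambda>x. if x \<in> carrier G then \<psi> (x \<otimes>\<^bsub>G\<^esub> g) else 0)"

lemma right_reg_ket:
  assumes "group G" "g \<in> carrier G" "x \<in> carrier G"
  shows "right_reg G g (ket x) = ket (x \<otimes>\<^bsub>G\<^esub> inv\<^bsub>G\<^esub> g)"
proof -
  interpret group G by fact
  show ?thesis
    using assms(2,3) by (auto simp: right_reg_def ket_def fun_eq_iff m_assoc)
qed

definition walk_op ::
  "('g, 'm) monoid_scheme \<Rightarrow> 'g set \<Rightarrow> ('g \<Rightarrow> complex) \<Rightarrow> ('g \<Rightarrow> complex) \<Rightarrow> ('g \<Rightarrow> complex)" where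
  "walk_op G S z \<psi> = (\<lambda>x. \<Sum>h\<in>S. z h * right_reg G h \<psi> x)"

definition scalar_quantum_walk ::
  "('g, 'm) monoid_scheme \<Rightarrow> 'g set \<Rightarrow> ('g \<Rightarrow> complex) \<Rightarrow> bool" where
  "scalar_quantum_walk G S z \<longleftrightarrow>
     finite S \<and> S \<subseteq> carrier G \<and> generate G S = carrier G \<and>
     (\<forall>h\<in>S. z h \<noteq> 0) \<and> unitary_on_ell2 (carrier G) (walk_op G S z)"


section \<open>The infinite dihedral group\<close>

text \<open>The semidirect product of the integers with the group of order two acting by inversion:
  \<open>(m, b)\<close> stands for \<open>a\<^sup>m\<close> if \<open>\<not> b\<close> and for \<open>a\<^sup>m r\<close> if \<open>b\<close>.\<close>

definition D_inf :: "(int \<times> bool) monoid" where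
  "D_inf = \<lparr>carrier = UNIV,
            mult = (\<lambda>(m, b) (n, c). (if b then m - n else m + n, b \<noteq> c)),
            one = (0, False)\<rparr>"

definition gen_a :: "int \<times> bool" where "gen_a = (1, False)"
definition gen_r :: "int \<times> bool" where "gen_r = (0, True)"

lemma group_D_inf: "group D_inf"
proof (rule groupI)
  fix x assume "x \<in> carrier D_inf"
  show "\<exists>y\<in>carrier D_inf. y \<otimes>\<^bsub>D_inf\<^esub> x = \<one>\<^bsub>D_inf\<^esub>"
    by (rule bexI[of _ "(if snd x then fst x else - fst x, snd x)"])
       (auto simp: D_inf_def split: prod.splits)
qed (auto simp: D_inf_def split: prod.splits)

lemma inv_D_inf: "inv\<^bsub>D_inf\<^esub> (n, b) = (if b then n else - n, b)"
proof -
  interpret group D_inf by (rule group_D_inf)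
  show ?thesis by (rule inv_equality) (auto simp: D_inf_def)
qed

lemma D_inf_relations:
  "gen_r \<otimes>\<^bsub>D_inf\<^esub> gen_r = \<one>\<^bsub>D_inf\<^esub>"
  "gen_r \<otimes>\<^bsub>D_inf\<^esub> gen_a \<otimes>\<^bsub>D_inf\<^esub> inv\<^bsub>D_inf\<^esub> gen_r \<otimes>\<^bsub>D_inf\<^esub> gen_a = \<one>\<^bsub>D_inf\<^esub>"
proof -
  interpret group D_inf by (rule group_D_inf)
  show 1: "gen_r \<otimes>\<^bsub>D_inf\<^esub> gen_r = \<one>\<^bsub>D_inf\<^esub>"
    by (simp add: D_inf_def gen_r_def)
  have "gen_r \<in> carrier D_inf" by (simp add: D_inf_def)
  with 1 have "inv\<^bsub>D_inf\<^esub> gen_r = gen_r" by (metis inv_equality)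
  then show "gen_r \<otimes>\<^bsub>D_inf\<^esub> gen_a \<otimes>\<^bsub>D_inf\<^esub> inv\<^bsub>D_inf\<^esub> gen_r \<otimes>\<^bsub>D_inf\<^esub> gen_a = \<one>\<^bsub>D_inf\<^esub>"
    by (simp add: D_inf_def gen_r_def gen_a_def)
qed

definition H_sub :: "(int \<times> bool) set" where
  "H_sub = generate D_inf {gen_a}"

lemma H_sub_eq: "H_sub = {(n, False) | n. True}"
proof -
  interpret group D_inf by (rule group_D_inf)
  have pow: "(n, False) \<in> generate D_inf {gen_a}" for n :: int
  proof (induction n rule: int_induct[where k = 0])
    case base
    then show ?case using generate.one[of D_inf "{gen_a}"] by (simp add: D_inf_def)
  next
    case (step1 i)
    then show ?case using generate.eng[OF step1(2) generate.incl[of gen_a "{gen_a}" D_inf]]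
      by (simp add: D_inf_def gen_a_def)
  next
    case (step2 i)
    have "inv\<^bsub>D_inf\<^esub> gen_a = (-1, False)"
      by (rule inv_equality) (auto simp: D_inf_def gen_a_def)
    then show ?case using generate.eng[OF step2(2) generate.inv[of gen_a "{gen_a}" D_inf]]
      by (simp add: D_inf_def)
  qed
  have "\<not> snd x" if "x \<in> generate D_inf {gen_a}" for x
    using that
  proof induction
    case (inv h)
    have "inv\<^bsub>D_inf\<^esub> gen_a = (-1, False)"
      by (rule inv_equality) (auto simp: D_inf_def gen_a_def)
    with inv show ?case by simp
  qed (auto simp: D_inf_def gen_a_def split: prod.splits)
  with pow show ?thesis by (force simp: H_sub_def)
qed

definition H_grp :: "(int \<times> bool) monoid" where
  "H_grp = D_inf\<lparr>carrier := H_sub\<rparr>"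


section \<open>Complex two-by-two matrices\<close>

definition cscale :: "complex \<Rightarrow> complex^2^2 \<Rightarrow> complex^2^2" (infixr "\<odot>" 75) where
  "c \<odot> M = (\<chi> i j. c * M $ i $ j)"

definition adj :: "complex^2^2 \<Rightarrow> complex^2^2" where
  "adj M = (\<chi> i j. cnj (M $ j $ i))"

definition unitary_matrix :: "complex^2^2 \<Rightarrow> bool" where
  "unitary_matrix U \<longleftrightarrow> U ** adj U = mat 1 \<and> adj U ** U = mat 1"

primrec mpow :: "complex^2^2 \<Rightarrow> nat \<Rightarrow> complex^2^2" where
  "mpow M 0 = mat 1"
| "mpow M (Suc n) = M ** mpow M n"

definition mexp :: "complex^2^2 \<Rightarrow> complex^2^2" where
  "mexp M = (\<Sum>n. (1 / fact n) *\<^sub>R mpow M n)"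

definition sigma_x :: "complex^2^2" where
  "sigma_x = vector [vector [0, 1], vector [1, 0]]"

lemma mpow_sigma_x: "mpow (c \<odot> sigma_x) n = (if even n then c^n \<odot> mat 1 else c^n \<odot> sigma_x)"
  by (induction n) (auto simp: vec_eq_iff forall_2 cscale_def sigma_x_def matrix_matrix_mult_def sum_2 mat_def)

lemma mexp_sigma_x: "mexp ((\<i> * of_real t) \<odot> sigma_x) = vector [vector [of_real (cos t), \<i> * of_real (sin t)],
     vector [\<i> * of_real (sin t), of_real (cos t)]]"
proof -
  let ?f = "\<lambda>n. (1 / fact n) *\<^sub>R mpow ((\<i> * of_real t) \<odot> sigma_x) n"
  have e: "(\<lambda>n. z ^ n /\<^sub>R fact n) sums exp z" for z :: complex by (rule exp_converges)
  have c: "(\<lambda>n. if even n then (\<i> * of_real t)^n /\<^sub>R fact n else 0) sums (cos t)"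
  proof -
    have 1: "(\<lambda>n. ((\<i> * complex_of_real t)^n /\<^sub>R fact n + (-(\<i> * complex_of_real t))^n /\<^sub>R fact n) / 2) =
          (\<lambda>n. if even n then (\<i> * complex_of_real t)^n /\<^sub>R fact n else 0)"
      by (rule ext) (simp add: scaleR_conv_of_real)
    have 2: "(exp (\<i> * complex_of_real t) + exp (-(\<i> * complex_of_real t))) / 2 = complex_of_real (cos t)"
      by (simp add: cos_exp_eq cos_of_real[symmetric])
    show ?thesis
      using sums_divide[OF sums_add[OF e[of "\<i> * of_real t"] e[of "-(\<i> * of_real t)"]], of 2]
      unfolding 1 2 .
  qed
  have s: "(\<lambda>n. if odd n then (\<i> * of_real t)^n /\<^sub>R fact n else 0) sums (\<i> * sin t)"
  proof -
    have 1: "(\<lambda>n. (\<i> * complex_of_real t)^n /\<^sub>R fact n - (if even n then (\<i> * complex_of_real t)^n /\<^sub>R fact n else 0)) =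
          (\<lambda>n. if odd n then (\<i> * complex_of_real t)^n /\<^sub>R fact n else 0)"
      by (rule ext) simp
    have 2: "exp (\<i> * complex_of_real t) - complex_of_real (cos t) = \<i> * complex_of_real (sin t)"
      by (simp add: exp_Euler cos_of_real[symmetric] sin_of_real[symmetric])
    show ?thesis
      using sums_diff[OF e[of "\<i> * of_real t"] c] unfolding 1 2 .
  qed
  have "?f sums vector [vector [of_real (cos t), \<i> * of_real (sin t)],
     vector [\<i> * of_real (sin t), of_real (cos t)]]"
    unfolding sums_def
  proof (intro vec_tendstoI)
    fix i j :: 2
    show "(\<lambda>n. (\<Sum>k<n. ?f k) $ i $ j) \<longlonglongrightarrow> (vector [vector [of_real (cos t), \<i> * of_real (sin t)],
     vector [\<i> * of_real (sin t), of_real (cos t)]] :: complex^2^2) $ i $ j"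
    proof -
      have "?f k $ i $ j = (if i = j then (if even k then (\<i> * of_real t)^k /\<^sub>R fact k else 0)
                            else (if odd k then (\<i> * of_real t)^k /\<^sub>R fact k else 0))" for k
      proof -
        have *: "sigma_x $ p $ q = (if p = q then 0 else 1)" for p q :: 2
          using exhaust_2[of p] exhaust_2[of q] by (auto simp: sigma_x_def)
        show ?thesis
          unfolding mpow_sigma_x
          by (cases "even k"; cases "i = j") (simp_all add: cscale_def mat_def divide_inverse *)
      qed
      then have "(\<lambda>n. (\<Sum>k<n. ?f k) $ i $ j) = (\<lambda>n. \<Sum>k<n.
          if i = j then (if even k then (\<i> * of_real t)^k /\<^sub>R fact k else 0)
          else (if odd k then (\<i> * of_real t)^k /\<^sub>R fact k else 0))"
        by (simp only: sum_component)
      then show ?thesis using c s exhaust_2[of i] exhaust_2[of j] by (auto simp: sums_def)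
    qed
  qed
  then show ?thesis unfolding mexp_def by (rule sums_unique[symmetric])
qed

definition A_D :: "real \<Rightarrow> real \<Rightarrow> real \<Rightarrow> real \<Rightarrow> complex^2^2" where
  "A_D \<nu> \<mu> s k = vector
     [vector [of_real \<nu> * exp (- \<i> * of_real k), \<i> * of_real s * of_real \<mu>],
      vector [\<i> * of_real s * of_real \<mu>, of_real \<nu> * exp (\<i> * of_real k)]]"


section \<open>Coarse-graining\<close>

text \<open>\<open>\<ell>\<^sup>2(H) \<otimes> \<complex>\<^sup>2\<close> is realised as \<open>\<ell>\<^sup>2(H \<times> {1, 2})\<close>, with \<open>|x\<rangle>|j\<rangle>\<close> being \<open>ket (x, j)\<close>. The index
  set is the library type \<open>2\<close>, whose only elements are \<open>1\<close> and \<open>2\<close>.\<close>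

definition coset_reps :: "(2 \<Rightarrow> int \<times> bool) \<Rightarrow> bool" where
  "coset_reps c \<longleftrightarrow> c 1 \<in> H_sub \<and> c 2 \<in> H_sub #>\<^bsub>D_inf\<^esub> gen_r"

definition U_H :: "(2 \<Rightarrow> int \<times> bool) \<Rightarrow> (int \<times> bool \<Rightarrow> complex) \<Rightarrow> ((int \<times> bool) \<times> 2 \<Rightarrow> complex)" where
  "U_H c \<psi> = (\<lambda>(x, j). if x \<in> H_sub then \<psi> (x \<otimes>\<^bsub>D_inf\<^esub> c j) else 0)"

definition U_H_adj :: "(2 \<Rightarrow> int \<times> bool) \<Rightarrow> ((int \<times> bool) \<times> 2 \<Rightarrow> complex) \<Rightarrow> (int \<times> bool \<Rightarrow> complex)" where
  "U_H_adj c \<phi> = (\<lambda>g. \<Sum>j\<in>UNIV. if g \<otimes>\<^bsub>D_inf\<^esub> inv\<^bsub>D_inf\<^esub> (c j) \<in> H_sub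
                                 then \<phi> (g \<otimes>\<^bsub>D_inf\<^esub> inv\<^bsub>D_inf\<^esub> (c j), j) else 0)"

lemma coset_repsD:
  assumes "coset_reps c"
  shows "snd (c 1) = False" "snd (c 2) = True"
  using assms by (auto simp: coset_reps_def H_sub_eq r_coset_def D_inf_def gen_r_def)

lemma coset_reps_cases:
  assumes "coset_reps c"
  obtains m n where "c 1 = (m, False)" "c 2 = (n, True)"
  using coset_repsD[OF assms] by (metis prod.collapse)

lemma U_H_ket:
  assumes "coset_reps c" "x \<in> H_sub"
  shows "U_H c (ket (x \<otimes>\<^bsub>D_inf\<^esub> c j)) = ket (x, j)"
proof (rule ext)
  fix p :: "(int \<times> bool) \<times> 2"
  obtain m n where c: "c 1 = (m, False)" "c 2 = (n, True)"
    using assms(1) by (rule coset_reps_cases)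
  obtain k where x: "x = (k, False)" using assms(2) by (auto simp: H_sub_eq)
  obtain y b i where p: "p = ((y, b), i)" by (metis prod.collapse)
  show "U_H c (ket (x \<otimes>\<^bsub>D_inf\<^esub> c j)) p = ket (x, j) p"
    using exhaust_2[of j] exhaust_2[of i] unfolding p x
    by (elim disjE) (simp_all add: c U_H_def ket_def H_sub_eq D_inf_def)
qed

lemma U_H_adj_ket:
  assumes "coset_reps c" "x \<in> H_sub"
  shows "U_H_adj c (ket (x, j)) = ket (x \<otimes>\<^bsub>D_inf\<^esub> c j)"
proof (rule ext)
  fix g :: "int \<times> bool"
  obtain m n where c: "c 1 = (m, False)" "c 2 = (n, True)"
    using assms(1) by (rule coset_reps_cases)
  obtain k where x: "x = (k, False)" using assms(2) by (auto simp: H_sub_eq)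
  obtain y b where g: "g = (y, b)" by (cases g)
  show "U_H_adj c (ket (x, j)) g = ket (x \<otimes>\<^bsub>D_inf\<^esub> c j) g"
    using exhaust_2[of j] unfolding g x U_H_adj_def sum_2 c inv_D_inf
    by (elim disjE; cases b) (auto simp: c ket_def H_sub_eq D_inf_def)
qed

definition coarse_graining ::
  "(2 \<Rightarrow> int \<times> bool) \<Rightarrow> ((int \<times> bool \<Rightarrow> complex) \<Rightarrow> (int \<times> bool \<Rightarrow> complex)) \<Rightarrow>
   ((int \<times> bool) \<times> 2 \<Rightarrow> complex) \<Rightarrow> ((int \<times> bool) \<times> 2 \<Rightarrow> complex)" where
  "coarse_graining c A = U_H c \<circ> A \<circ> U_H_adj c"

definition tau :: "(2 \<Rightarrow> int \<times> bool) \<Rightarrow> int \<times> bool \<Rightarrow> 2 \<Rightarrow> 2" where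
  "tau c h j = (THE i. c j \<otimes>\<^bsub>D_inf\<^esub> inv\<^bsub>D_inf\<^esub> h \<in> H_sub #>\<^bsub>D_inf\<^esub> c i)"

lemma tau_coset:
  assumes "coset_reps c"
  shows "c j \<otimes>\<^bsub>D_inf\<^esub> inv\<^bsub>D_inf\<^esub> h \<in> H_sub #>\<^bsub>D_inf\<^esub> c (tau c h j)"
proof -
  obtain m n where c: "c 1 = (m, False)" "c 2 = (n, True)"
    using assms by (rule coset_reps_cases)
  have *: "x \<in> H_sub #>\<^bsub>D_inf\<^esub> c i \<longleftrightarrow> snd x = snd (c i)" for x i
  proof
    assume "snd x = snd (c i)"
    then have "x = (fst x - fst (c i), False) \<otimes>\<^bsub>D_inf\<^esub> c i"
      by (cases x; cases "c i") (simp add: D_inf_def)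
    then show "x \<in> H_sub #>\<^bsub>D_inf\<^esub> c i" by (auto simp: r_coset_def H_sub_eq)
  qed (cases "c i", auto simp: r_coset_def H_sub_eq D_inf_def)
  have "\<exists>!i. snd x = snd (c i)" for x :: "int \<times> bool"
  proof (cases "snd x")
    case True
    show ?thesis
    proof (rule ex1I[of _ 2])
      show "i = 2" if "snd x = snd (c i)" for i using that True c exhaust_2[of i] by auto
    qed (use True c in simp)
  next
    case False
    show ?thesis
    proof (rule ex1I[of _ 1])
      show "i = 1" if "snd x = snd (c i)" for i using that False c exhaust_2[of i] by auto
    qed (use False c in simp)
  qed
  then show ?thesis unfolding tau_def * by (rule theI')
qed

definition coordination_number_two :: "(2 \<Rightarrow> int \<times> bool) \<Rightarrow> (int \<times> bool) set \<Rightarrow> bool" where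
  "coordination_number_two c S \<longleftrightarrow>
     (\<forall>h\<in>S. \<forall>j. c (tau c h j) \<otimes>\<^bsub>D_inf\<^esub> h \<otimes>\<^bsub>D_inf\<^esub> inv\<^bsub>D_inf\<^esub> (c j)
        \<in> {\<one>\<^bsub>D_inf\<^esub>, gen_a, inv\<^bsub>D_inf\<^esub> gen_a})"

definition tensor_op ::
  "(('a \<Rightarrow> complex) \<Rightarrow> ('a \<Rightarrow> complex)) \<Rightarrow> complex^2^2 \<Rightarrow> ('a \<times> 2 \<Rightarrow> complex) \<Rightarrow> ('a \<times> 2 \<Rightarrow> complex)" where
  "tensor_op B M \<phi> = (\<lambda>(x, i). \<Sum>j\<in>UNIV. M $ i $ j * B (\<lambda>y. \<phi> (y, j)) x)"

text \<open>Symbols are functions on \<open>[-\<pi>, \<pi>]\<close>, extended by \<open>undefined\<close> (the library's restriction).\<close>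

definition has_symbol ::
  "(((int \<times> bool) \<times> 2 \<Rightarrow> complex) \<Rightarrow> ((int \<times> bool) \<times> 2 \<Rightarrow> complex)) \<Rightarrow> (real \<Rightarrow> complex^2^2) \<Rightarrow> bool" where
  "has_symbol W S \<longleftrightarrow> (\<exists>Ap Am Ae.
     (\<forall>\<phi>\<in>ell2 (H_sub \<times> UNIV). W \<phi> = (\<lambda>p.
         tensor_op (right_reg H_grp gen_a) Ap \<phi> p
       + tensor_op (right_reg H_grp (inv\<^bsub>H_grp\<^esub> gen_a)) Am \<phi> p
       + tensor_op (right_reg H_grp \<one>\<^bsub>H_grp\<^esub>) Ae \<phi> p)) \<and>
     S = (\<lambda>k\<in>{-pi..pi}. exp (- \<i> * of_real k) \<odot> Ap + exp (\<i> * of_real k) \<odot> Am + Ae))"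

definition W_CG :: "(real \<Rightarrow> complex^2^2) set" where
  "W_CG = {(\<lambda>k\<in>{-pi..pi}. U ** A k ** adj U) | U A. unitary_matrix U \<and>
     (\<exists>S z c. scalar_quantum_walk D_inf S z \<and> coset_reps c \<and> coordination_number_two c S \<and>
              has_symbol (coarse_graining c (walk_op D_inf S z)) A)}"

end

theory Submission
  imports Defs
begin

text \<open>A walk on a group is unitary iff its amplitudes satisfy finitely many quadratic equations, the
  coefficients of \<open>A\<^sup>\<dagger> A = 1\<close> and \<open>A A\<^sup>\<dagger> = 1\<close> in the group algebra. Coordination number two leaves six
  amplitudes: three translations and three reflections. The symbol then satisfies
  \<open>\<sigma>\<^sub>x A\<^sub>k \<sigma>\<^sub>x = A\<^sub>-\<^sub>k\<close>, and the equations force \<open>A\<^sub>+\<close> to be a rank-one matrix of the form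
  \<open>e\<^sup>i\<^sup>\<eta> \<nu> R(\<alpha>) E\<^sub>1\<^sub>1 R(\<beta>)\<close> with \<open>R(t) = exp (i t \<sigma>\<^sub>x)\<close>, and then determine \<open>A\<^sub>e\<close> up to a real parameter.
  The case \<open>\<nu> = 0\<close> is excluded because the support would generate a finite group. A change of basis
  by \<open>R(\<phi>)\<close> moves both angles into the allowed ranges; conversely, for angles in these ranges all
  four amplitudes of nonzero displacement are nonzero, so that the support generates the group.\<close>

section \<open>Unitary walks on a group\<close>

lemma ell2_add:
  assumes "\<phi> \<in> ell2 X" "\<psi> \<in> ell2 X"
  shows "(\<lambda>x. \<phi> x + \<psi> x) \<in> ell2 X"
proof -
  have "(\<lambda>x. 2 * (cmod (\<phi> x))\<^sup>2 + 2 * (cmod (\<psi> x))\<^sup>2) summable_on X"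
    using assms by (intro summable_on_add summable_on_cmult_right) (auto simp: ell2_def)
  moreover have "(cmod (\<phi> x + \<psi> x))\<^sup>2 \<le> 2 * (cmod (\<phi> x))\<^sup>2 + 2 * (cmod (\<psi> x))\<^sup>2" for x
  proof -
    have "(cmod (\<phi> x + \<psi> x))\<^sup>2 \<le> (cmod (\<phi> x) + cmod (\<psi> x))\<^sup>2"
      by (intro power_mono norm_triangle_ineq) auto
    also have "\<dots> \<le> 2 * (cmod (\<phi> x))\<^sup>2 + 2 * (cmod (\<psi> x))\<^sup>2"
      using sum_squares_bound[of "cmod (\<phi> x)" "cmod (\<psi> x)"] by (simp add: power2_sum)
    finally show ?thesis .
  qed
  ultimately have "(\<lambda>x. (cmod (\<phi> x + \<psi> x))\<^sup>2) summable_on X"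
    by (rule summable_on_comparison_test) auto
  then show ?thesis using assms by (auto simp: ell2_def)
qed

lemma ell2_cmult:
  assumes "\<phi> \<in> ell2 X"
  shows "(\<lambda>x. c * \<phi> x) \<in> ell2 X"
  using assms by (auto simp: ell2_def norm_mult power_mult_distrib intro: summable_on_cmult_right)

lemma ell2_sum:
  assumes "finite S" "\<And>h. h \<in> S \<Longrightarrow> f h \<in> ell2 X"
  shows "(\<lambda>x. \<Sum>h\<in>S. c h * f h x) \<in> ell2 X"
  using assms
proof (induction S rule: finite_induct)
  case empty
  then show ?case by (simp add: ell2_def)
next
  case (insert h S)
  then show ?case
    using ell2_add[OF ell2_cmult[of "f h" X "c h"], of "\<lambda>x. \<Sum>h\<in>S. c h * f h x"] by simp
qed

lemma ket_in_ell2: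
  assumes "x \<in> X"
  shows "ket x \<in> ell2 X"
proof -
  have "(\<lambda>y. (cmod (ket x y))\<^sup>2) summable_on {x}" by (rule summable_on_finite) simp
  then have "(\<lambda>y. (cmod (ket x y))\<^sup>2) summable_on X"
    by (rule summable_on_cong_neutral[THEN iffD1, rotated -1]) (use assms in \<open>auto simp: ket_def\<close>)
  then show ?thesis using assms by (auto simp: ell2_def ket_def)
qed

lemma ell2_inner_summable:
  assumes "\<phi> \<in> ell2 X" "\<psi> \<in> ell2 X"
  shows "(\<lambda>x. cnj (\<phi> x) * \<psi> x) summable_on X"
proof (rule abs_summable_summable)
  have "(\<lambda>x. (cmod (\<phi> x))\<^sup>2 + (cmod (\<psi> x))\<^sup>2) summable_on X"
    using assms by (intro summable_on_add) (auto simp: ell2_def)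
  then show "(\<lambda>x. norm (cnj (\<phi> x) * \<psi> x)) summable_on X"
  proof (rule summable_on_comparison_test)
    fix x
    show "norm (cnj (\<phi> x) * \<psi> x) \<le> (cmod (\<phi> x))\<^sup>2 + (cmod (\<psi> x))\<^sup>2"
      using sum_squares_bound[of "cmod (\<phi> x)" "cmod (\<psi> x)"]
        mult_nonneg_nonneg[OF norm_ge_zero norm_ge_zero, of "\<phi> x" "\<psi> x"]
      unfolding norm_mult complex_mod_cnj by linarith
  qed auto
qed

lemma ell2_inner_ket_left:
  assumes "x \<in> X"
  shows "ell2_inner X (ket x) \<psi> = \<psi> x"
proof -
  have "ell2_inner X (ket x) \<psi> = (\<Sum>\<^sub>\<infinity>y\<in>{x}. cnj (ket x y) * \<psi> y)"
    unfolding ell2_inner_def by (rule infsum_cong_neutral) (use assms in \<open>auto simp: ket_def\<close>)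
  then show ?thesis by (simp add: ket_def)
qed

lemma ell2_inner_cnj: "ell2_inner X \<psi> \<phi> = cnj (ell2_inner X \<phi> \<psi>)"
  unfolding ell2_inner_def infsum_cnj[symmetric] by (simp add: mult.commute)

lemma infsum_finite_sum:
  fixes f :: "'h \<Rightarrow> 'a \<Rightarrow> complex"
  assumes "finite S" "\<And>h. h \<in> S \<Longrightarrow> f h summable_on X"
  shows "(\<Sum>\<^sub>\<infinity>x\<in>X. \<Sum>h\<in>S. f h x) = (\<Sum>h\<in>S. infsum (f h) X)"
proof -
  have "((\<lambda>x. \<Sum>h\<in>S. f h x) has_sum (\<Sum>h\<in>S. infsum (f h) X)) X"
    using assms
  proof (induction S rule: finite_induct)
    case empty
    then show ?case by simp
  next
    case (insert h S)
    then show ?case using has_sum_add[of "f h" X "infsum (f h) X"] by auto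
  qed
  then show ?thesis by (rule infsumI)
qed

lemma ell2_inner_sum_right:
  fixes f :: "'h \<Rightarrow> 'a \<Rightarrow> complex"
  assumes "finite S" "\<phi> \<in> ell2 X" "\<And>h. h \<in> S \<Longrightarrow> f h \<in> ell2 X"
  shows "ell2_inner X \<phi> (\<lambda>x. \<Sum>h\<in>S. c h * f h x) = (\<Sum>h\<in>S. c h * ell2_inner X \<phi> (f h))"
proof -
  have "ell2_inner X \<phi> (\<lambda>x. \<Sum>h\<in>S. c h * f h x) =
      (\<Sum>\<^sub>\<infinity>x\<in>X. \<Sum>h\<in>S. c h * (cnj (\<phi> x) * f h x))"
    by (simp add: ell2_inner_def sum_distrib_left mult.left_commute)
  also have "\<dots> = (\<Sum>h\<in>S. \<Sum>\<^sub>\<infinity>x\<in>X. c h * (cnj (\<phi> x) * f h x))"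
    by (intro infsum_finite_sum summable_on_cmult_right ell2_inner_summable assms)
  also have "\<dots> = (\<Sum>h\<in>S. c h * ell2_inner X \<phi> (f h))"
    using assms by (auto simp: ell2_inner_def intro!: sum.cong infsum_cmult_right ell2_inner_summable)
  finally show ?thesis .
qed

lemma ell2_inner_sum_left:
  fixes f :: "'h \<Rightarrow> 'a \<Rightarrow> complex"
  assumes "finite S" "\<phi> \<in> ell2 X" "\<And>h. h \<in> S \<Longrightarrow> f h \<in> ell2 X"
  shows "ell2_inner X (\<lambda>x. \<Sum>h\<in>S. c h * f h x) \<phi> = (\<Sum>h\<in>S. cnj (c h) * ell2_inner X (f h) \<phi>)"
  using ell2_inner_sum_right[where c = c, OF assms]
  by (subst ell2_inner_cnj) (simp add: ell2_inner_cnj[of X _ \<phi>])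

section \<open>Right translations and the group-algebra criterion for unitarity\<close>

context group
begin

lemma bij_betw_right_mult:
  assumes "g \<in> carrier G"
  shows "bij_betw (\<lambda>x. x \<otimes> g) (carrier G) (carrier G)"
  by (rule bij_betw_byWitness[where f' = "\<lambda>x. x \<otimes> inv g"]) (use assms in \<open>auto simp: m_assoc\<close>)

lemma right_reg_ell2:
  assumes "g \<in> carrier G" "\<psi> \<in> ell2 (carrier G)"
  shows "right_reg G g \<psi> \<in> ell2 (carrier G)"
proof -
  have "(\<lambda>x. (cmod (\<psi> (x \<otimes> g)))\<^sup>2) summable_on carrier G"
    using assms summable_on_reindex_bij_betw[OF bij_betw_right_mult[OF assms(1)], of "\<lambda>x. (cmod (\<psi> x))\<^sup>2"]
    by (simp add: ell2_def)
  then have "(\<lambda>x. (cmod (right_reg G g \<psi> x))\<^sup>2) summable_on carrier G"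
    by (rule summable_on_cong[THEN iffD1, rotated]) (simp add: right_reg_def)
  then show ?thesis by (simp add: ell2_def right_reg_def)
qed

text \<open>Substituting \<open>x \<otimes> h\<close> for \<open>x\<close> in the sum; in operator
  terms, the adjoint of translation by \<open>h\<close> is translation by
  \<open>inv h\<close>.\<close>

lemma ell2_inner_right_reg:
  assumes "g \<in> carrier G" "h \<in> carrier G"
  shows "ell2_inner (carrier G) (right_reg G h \<phi>) (right_reg G g \<psi>) =
    ell2_inner (carrier G) \<phi> (right_reg G (inv h \<otimes> g) \<psi>)"
proof -
  have "ell2_inner (carrier G) \<phi> (right_reg G (inv h \<otimes> g) \<psi>) =
     (\<Sum>\<^sub>\<infinity>x\<in>carrier G. cnj (\<phi> (x \<otimes> h)) * right_reg G (inv h \<otimes> g) \<psi> (x \<otimes> h))"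
    unfolding ell2_inner_def by (rule infsum_reindex_bij_betw[OF bij_betw_right_mult[OF assms(2)], symmetric])
  also have "\<dots> = ell2_inner (carrier G) (right_reg G h \<phi>) (right_reg G g \<psi>)"
    unfolding ell2_inner_def
    by (rule infsum_cong) (use assms in \<open>simp add: right_reg_def m_assoc m_assoc[of h "inv h" g, symmetric]\<close>)
  finally show ?thesis by simp
qed

lemma right_reg_one: "\<psi> \<in> ell2 (carrier G) \<Longrightarrow> right_reg G \<one> \<psi> = \<psi>"
  by (auto simp: right_reg_def ell2_def)

lemma walk_op_ell2:
  assumes "finite S" "S \<subseteq> carrier G" "\<psi> \<in> ell2 (carrier G)"
  shows "walk_op G S z \<psi> \<in> ell2 (carrier G)"
  unfolding walk_op_def using assms by (intro ell2_sum right_reg_ell2) auto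

text \<open>Translation by \<open>h\<close> moves the ket at \<open>y\<close> to
  \<open>y \<otimes> inv h\<close>, so only \<open>h = inv x \<otimes> y\<close> contributes. As
  \<open>z\<close> vanishes outside \<open>S\<close>, this matrix element needs no case
  distinction.\<close>

lemma walk_op_ket:
  assumes "finite S" "S \<subseteq> carrier G" "\<And>h. h \<notin> S \<Longrightarrow> z h = 0" "x \<in> carrier G" "y \<in> carrier G"
  shows "walk_op G S z (ket y) x = z (inv x \<otimes> y)"
proof -
  have "walk_op G S z (ket y) x = (\<Sum>h\<in>S. if h = inv x \<otimes> y then z h else 0)"
    unfolding walk_op_def
    by (rule sum.cong) (use assms in \<open>auto simp: right_reg_def ket_def inv_solve_left m_assoc[symmetric]\<close>)
  then show ?thesis using assms by simp
qed

text \<open>Reindexing by \<open>y = inv h \<otimes> g\<close>, then enlarging the range to all such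
  quotients, where the new terms vanish because \<open>z\<close> does. The final range is
  independent of \<open>h\<close>, so a sum over \<open>h\<close> can be interchanged with
  it.\<close>

lemma left_conv_sum:
  fixes z F :: "'a \<Rightarrow> complex"
  assumes "finite S" "S \<subseteq> carrier G" "\<And>h. h \<notin> S \<Longrightarrow> z h = 0" "h \<in> S"
  shows "(\<Sum>g\<in>S. z g * F (inv h \<otimes> g)) =
    (\<Sum>y\<in>(\<lambda>(h, g). inv h \<otimes> g) ` (S \<times> S). z (h \<otimes> y) * F y)"
proof -
  have h: "h \<in> carrier G" using assms by auto
  have "inj_on (\<lambda>g. inv h \<otimes> g) S"
    using assms(2) h by (intro inj_onI) (auto simp: subset_iff)
  then have "(\<Sum>g\<in>S. z g * F (inv h \<otimes> g)) = (\<Sum>y\<in>(\<lambda>g. inv h \<otimes> g) ` S. z (h \<otimes> y) * F y)"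
    by (subst sum.reindex) (use assms(2) h in \<open>auto simp: m_assoc[symmetric] subset_iff intro!: sum.cong\<close>)
  also have "\<dots> = (\<Sum>y\<in>(\<lambda>(h, g). inv h \<otimes> g) ` (S \<times> S). z (h \<otimes> y) * F y)"
  proof (rule sum.mono_neutral_left)
    show "\<forall>y\<in>(\<lambda>(h, g). inv h \<otimes> g) ` (S \<times> S) - (\<lambda>g. inv h \<otimes> g) ` S. z (h \<otimes> y) * F y = 0"
    proof
      fix y assume y: "y \<in> (\<lambda>(h, g). inv h \<otimes> g) ` (S \<times> S) - (\<lambda>g. inv h \<otimes> g) ` S"
      then have "y \<in> carrier G" using assms(2) by auto
      then have "y = inv h \<otimes> (h \<otimes> y)" using h by (simp add: m_assoc[symmetric])
      with y have "h \<otimes> y \<notin> S" by blast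
      then show "z (h \<otimes> y) * F y = 0" using assms(3) by simp
    qed
  qed (use assms in auto)
  finally show ?thesis .
qed

text \<open>The two sums are the coefficients of the adjoint times the walk at \<open>y\<close> and
  of the walk times its adjoint at \<open>inv y\<close>. The first family makes inner products
  invariant; the second makes the adjoint a right inverse, hence the walk surjective.\<close>

lemma unitary_walk_opI:
  assumes S: "finite S" "S \<subseteq> carrier G" and z: "\<And>h. h \<notin> S \<Longrightarrow> z h = 0"
    and left: "\<And>y. y \<in> carrier G \<Longrightarrow> (\<Sum>h\<in>S. cnj (z h) * z (h \<otimes> y)) = (if y = \<one> then 1 else 0)"
    and right: "\<And>y. y \<in> carrier G \<Longrightarrow> (\<Sum>h\<in>S. z h * cnj (z (y \<otimes> h))) = (if y = \<one> then 1 else 0)"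
  shows "unitary_on_ell2 (carrier G) (walk_op G S z)"
  unfolding unitary_on_ell2_def
proof (intro conjI ballI allI)
  fix \<phi> \<psi> :: "'a \<Rightarrow> complex" and a b
  show "walk_op G S z (\<lambda>x. a * \<phi> x + b * \<psi> x) = (\<lambda>x. a * walk_op G S z \<phi> x + b * walk_op G S z \<psi> x)"
    by (auto simp: walk_op_def right_reg_def fun_eq_iff sum_distrib_left sum.distrib[symmetric]
        algebra_simps intro!: sum.cong)
next
  let ?Y = "(\<lambda>(h, g). inv h \<otimes> g) ` (S \<times> S)"
  fix \<phi> \<psi> :: "'a \<Rightarrow> complex"
  assume \<phi>: "\<phi> \<in> ell2 (carrier G)" and \<psi>: "\<psi> \<in> ell2 (carrier G)"
  \<comment> \<open>The inner product of the images becomes the pairing of \<open>F\<close> with the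
    group-algebra coefficients, which \<open>left\<close> reduces to the single term at
    \<open>\<one>\<close>.\<close>
  define F where "F = (\<lambda>y. ell2_inner (carrier G) \<phi> (right_reg G y \<psi>))"
  have "ell2_inner (carrier G) (walk_op G S z \<phi>) (walk_op G S z \<psi>) =
      (\<Sum>h\<in>S. cnj (z h) * (\<Sum>g\<in>S. z g * F (inv h \<otimes> g)))"
  proof -
    have "ell2_inner (carrier G) (walk_op G S z \<phi>) (walk_op G S z \<psi>) =
      (\<Sum>h\<in>S. cnj (z h) * ell2_inner (carrier G) (right_reg G h \<phi>) (walk_op G S z \<psi>))"
      unfolding walk_op_def[of _ _ _ \<phi>]
      by (rule ell2_inner_sum_left) (use S \<phi> \<psi> in \<open>auto intro: walk_op_ell2 right_reg_ell2\<close>)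
    also have "\<dots> = (\<Sum>h\<in>S. cnj (z h) *
        (\<Sum>g\<in>S. z g * ell2_inner (carrier G) (right_reg G h \<phi>) (right_reg G g \<psi>)))"
      unfolding walk_op_def
      by (intro sum.cong refl arg_cong2[where f = "(*)"] ell2_inner_sum_right)
        (use S \<phi> \<psi> in \<open>auto intro: right_reg_ell2\<close>)
    finally show ?thesis
      using S by (simp add: F_def ell2_inner_right_reg subset_iff cong: sum.cong)
  qed
  also have "\<dots> = (\<Sum>h\<in>S. cnj (z h) * (\<Sum>y\<in>?Y. z (h \<otimes> y) * F y))"
    using left_conv_sum[OF S, of z] z by (intro sum.cong) auto
  also have "\<dots> = (\<Sum>y\<in>?Y. (\<Sum>h\<in>S. cnj (z h) * z (h \<otimes> y)) * F y)"
    by (simp add: sum_distrib_left sum_distrib_right mult.assoc) (rule sum.swap)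
  also have "\<dots> = (\<Sum>y\<in>?Y. if y = \<one> then F y else 0)"
    using S(2) by (intro sum.cong refl) (subst left, auto)
  also have "\<dots> = ell2_inner (carrier G) \<phi> \<psi>"
  proof -
    \<comment> \<open>An empty \<open>S\<close> would contradict \<open>left\<close> at
      \<open>\<one>\<close>; any \<open>h\<close> in \<open>S\<close> then gives
      \<open>\<one> = inv h \<otimes> h\<close>.\<close>
    have "S \<noteq> {}" using left[of \<one>] by auto
    then obtain h where "h \<in> S" by auto
    then have "\<one> \<in> ?Y" using S by (force simp: image_iff)
    then show ?thesis using S \<psi> by (simp add: F_def right_reg_one)
  qed
  finally show "ell2_inner (carrier G) (walk_op G S z \<phi>) (walk_op G S z \<psi>) =
      ell2_inner (carrier G) \<phi> \<psi>" .
next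
  show "walk_op G S z ` ell2 (carrier G) = ell2 (carrier G)"
  proof (intro equalityI subsetI)
    fix \<psi> assume \<psi>: "\<psi> \<in> ell2 (carrier G)"
    \<comment> \<open>The adjoint walk applied to \<open>\<psi>\<close>: amplitudes are conjugated
      and moved to the inverse elements.\<close>
    define \<phi> where "\<phi> = walk_op G (m_inv G ` S) (\<lambda>h. cnj (z (inv h))) \<psi>"
    have fin: "finite (m_inv G ` S)" "m_inv G ` S \<subseteq> carrier G" using S by auto
    have "\<phi> \<in> ell2 (carrier G)" unfolding \<phi>_def by (rule walk_op_ell2[OF fin \<psi>])
    moreover have "walk_op G S z \<phi> = \<psi>"
    proof
      fix x
      show "walk_op G S z \<phi> x = \<psi> x"
      proof (cases "x \<in> carrier G")
        case False
        then show ?thesis using \<psi> by (simp add: walk_op_def right_reg_def ell2_def)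
      next
        case x: True
        have phi: "\<phi> y = (\<Sum>g\<in>S. cnj (z g) * \<psi> (y \<otimes> inv g))" if "y \<in> carrier G" for y
          unfolding \<phi>_def walk_op_def using S that
          by (subst sum.reindex) (auto intro!: inj_on_subset[OF inv_inj] sum.cong simp: right_reg_def subset_iff)
        \<comment> \<open>A common range for \<open>y = g \<otimes> inv h\<close>, with
          \<open>x \<otimes> h \<otimes> inv g = x \<otimes> inv y\<close>.\<close>
        define Y where "Y = (\<lambda>(g, h). g \<otimes> inv h) ` (S \<times> S)"
        have conv: "(\<Sum>g\<in>S. cnj (z g) * \<psi> (x \<otimes> h \<otimes> inv g)) =
            (\<Sum>y\<in>Y. cnj (z (y \<otimes> h)) * \<psi> (x \<otimes> inv y))" if h: "h \<in> S" for h
        proof -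
          have hG: "h \<in> carrier G" using h S by auto
          have inj: "inj_on (\<lambda>g. g \<otimes> inv h) S" using S hG by (intro inj_onI) (auto simp: subset_iff)
          have "(\<Sum>y\<in>Y. cnj (z (y \<otimes> h)) * \<psi> (x \<otimes> inv y)) =
             (\<Sum>y\<in>(\<lambda>g. g \<otimes> inv h) ` S. cnj (z (y \<otimes> h)) * \<psi> (x \<otimes> inv y))"
          proof (rule sum.mono_neutral_right)
            show "\<forall>y\<in>Y - (\<lambda>g. g \<otimes> inv h) ` S. cnj (z (y \<otimes> h)) * \<psi> (x \<otimes> inv y) = 0"
            proof
              fix y assume y: "y \<in> Y - (\<lambda>g. g \<otimes> inv h) ` S"
              then have "y \<in> carrier G" using S(2) by (auto simp: Y_def)
              then have "y = (y \<otimes> h) \<otimes> inv h" using hG by (simp add: m_assoc)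
              with y have "y \<otimes> h \<notin> S" by blast
              then show "cnj (z (y \<otimes> h)) * \<psi> (x \<otimes> inv y) = 0" using z by simp
            qed
          qed (use S h in \<open>auto simp: Y_def\<close>)
          also have "\<dots> = (\<Sum>g\<in>S. cnj (z g) * \<psi> (x \<otimes> h \<otimes> inv g))"
            unfolding sum.reindex[OF inj]
            by (rule sum.cong) (use S hG x in \<open>auto simp: m_assoc subset_iff inv_mult_group\<close>)
          finally show ?thesis by simp
        qed
        have "walk_op G S z \<phi> x = (\<Sum>h\<in>S. z h * (\<Sum>g\<in>S. cnj (z g) * \<psi> (x \<otimes> h \<otimes> inv g)))"
          unfolding walk_op_def using x S by (auto simp: right_reg_def phi subset_iff intro!: sum.cong)
        also have "\<dots> = (\<Sum>y\<in>Y. (\<Sum>h\<in>S. z h * cnj (z (y \<otimes> h))) * \<psi> (x \<otimes> inv y))"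
          by (simp add: conv sum_distrib_left sum_distrib_right mult.assoc cong: sum.cong) (rule sum.swap)
        also have "\<dots> = (\<Sum>y\<in>Y. if y = \<one> then \<psi> (x \<otimes> inv y) else 0)"
          using S(2) by (intro sum.cong refl) (subst right, auto simp: Y_def)
        also have "\<dots> = \<psi> x"
        proof -
          have "S \<noteq> {}" using right[of \<one>] by auto
          then obtain h where "h \<in> S" by auto
          then have "\<one> \<in> Y" using S by (force simp: image_iff Y_def)
          moreover have "finite Y" using S by (simp add: Y_def)
          ultimately show ?thesis using x by simp
        qed
        finally show ?thesis .
      qed
    qed
    ultimately show "\<psi> \<in> walk_op G S z ` ell2 (carrier G)" by blast
  qed (use S in \<open>auto intro: walk_op_ell2\<close>)
qed

text \<open>The inner product of the kets at \<open>\<one>\<close> and \<open>y\<close> is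
  preserved, and \<open>walk_op_ket\<close> evaluates both images; replacing \<open>x\<close> by its
  inverse yields the sum over \<open>h\<close>.\<close>

lemma unitary_walk_op_left:
  assumes S: "finite S" "S \<subseteq> carrier G" and z: "\<And>h. h \<notin> S \<Longrightarrow> z h = 0"
    and U: "unitary_on_ell2 (carrier G) (walk_op G S z)" and y: "y \<in> carrier G"
  shows "(\<Sum>h\<in>S. cnj (z h) * z (h \<otimes> y)) = (if y = \<one> then 1 else 0)"
proof -
  have "(if y = \<one> then 1 else 0) = ell2_inner (carrier G) (ket \<one>) (ket y)"
    by (simp add: ell2_inner_ket_left) (simp add: ket_def)
  also have "\<dots> = ell2_inner (carrier G) (walk_op G S z (ket \<one>)) (walk_op G S z (ket y))"
    using U y by (simp add: unitary_on_ell2_def ket_in_ell2)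
  also have "\<dots> = (\<Sum>\<^sub>\<infinity>x\<in>carrier G. cnj (z (inv x)) * z (inv x \<otimes> y))"
    unfolding ell2_inner_def by (rule infsum_cong) (use S z y in \<open>simp add: walk_op_ket\<close>)
  also have "\<dots> = (\<Sum>\<^sub>\<infinity>h\<in>carrier G. cnj (z h) * z (h \<otimes> y))"
    by (rule infsum_reindex_bij_betw[where g = "m_inv G" and f = "\<lambda>h. cnj (z h) * z (h \<otimes> y)"])
      (rule bij_betw_byWitness[where f' = "m_inv G"], auto)
  also have "\<dots> = (\<Sum>\<^sub>\<infinity>h\<in>S. cnj (z h) * z (h \<otimes> y))"
    by (rule infsum_cong_neutral) (use S z in auto)
  finally show ?thesis using S by simp
qed

text \<open>A preimage of \<open>ket \<one>\<close> under the walk is determined by its inner products with kets, which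
  turns surjectivity into the second family of coefficient identities.\<close>

lemma unitary_walk_op_right:
  assumes S: "finite S" "S \<subseteq> carrier G" and z: "\<And>h. h \<notin> S \<Longrightarrow> z h = 0"
    and U: "unitary_on_ell2 (carrier G) (walk_op G S z)" and y: "y \<in> carrier G"
  shows "(\<Sum>h\<in>S. z h * cnj (z (y \<otimes> h))) = (if y = \<one> then 1 else 0)"
proof -
  have "ket \<one> \<in> walk_op G S z ` ell2 (carrier G)"
    using U by (simp add: unitary_on_ell2_def ket_in_ell2)
  then obtain \<phi> where \<phi>: "\<phi> \<in> ell2 (carrier G)" "walk_op G S z \<phi> = ket \<one>" by force
  have phi: "\<phi> w = cnj (z w)" if w: "w \<in> carrier G" for w
  proof -
    have "\<phi> w = ell2_inner (carrier G) (ket w) \<phi>" using w by (simp add: ell2_inner_ket_left)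
    also have "\<dots> = ell2_inner (carrier G) (walk_op G S z (ket w)) (ket \<one>)"
      using U \<phi> w by (simp add: unitary_on_ell2_def ket_in_ell2 flip: \<phi>(2))
    also have "\<dots> = cnj (walk_op G S z (ket w) \<one>)"
      by (subst ell2_inner_cnj) (simp add: ell2_inner_ket_left)
    finally show ?thesis using S z w by (simp add: walk_op_ket)
  qed
  have "ket \<one> y = (\<Sum>h\<in>S. z h * \<phi> (y \<otimes> h))"
    unfolding \<phi>(2)[symmetric] walk_op_def using y by (simp add: right_reg_def)
  then show ?thesis using S y by (simp add: phi subset_iff ket_def cong: sum.cong)
qed

end

section \<open>Nearest-neighbour walks on the infinite dihedral group\<close>

lemma D_inf_simps [simp]:
  "carrier D_inf = UNIV"
  "(m, b) \<otimes>\<^bsub>D_inf\<^esub> (n, c) = (if b then m - n else m + n, b \<noteq> c)"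
  "\<one>\<^bsub>D_inf\<^esub> = (0, False)"
  by (simp_all add: D_inf_def)

text \<open>Translations preserve the two cosets of \<open>H_sub\<close> and reflections exchange
  them.\<close>

lemma tau_eq:
  assumes "coset_reps c"
  shows "tau c (p, b) j = (if b then (if j = 1 then 2 else 1) else j)"
proof -
  obtain m n where c: "c 1 = (m, False)" "c 2 = (n, True)"
    using assms by (rule coset_reps_cases)
  show ?thesis
    using tau_coset[OF assms, of j "(p, b)"] exhaust_2[of j] exhaust_2[of "tau c (p, b) j"]
    by (auto simp: c inv_D_inf H_sub_eq r_coset_def split: if_splits)
qed

text \<open>The group elements by which a coarse-grained walk moves at most one cell; \<open>d\<close> is the offset
  between the two coset representatives.\<close>

definition hop_set :: "int \<Rightarrow> (int \<times> bool) set" where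
  "hop_set d = {(-1, False), (0, False), (1, False), (d - 1, True), (d, True), (d + 1, True)}"

lemma finite_hop_set [simp]: "finite (hop_set d)"
  by (simp add: hop_set_def)

lemma sum_hop_set:
  fixes f :: "int \<times> bool \<Rightarrow> 'a::comm_monoid_add"
  shows "sum f (hop_set d) =
    f (-1, False) + (f (0, False) + (f (1, False) + (f (d - 1, True) + (f (d, True) + f (d + 1, True)))))"
  by (simp add: hop_set_def)

definition reps_offset :: "(2 \<Rightarrow> int \<times> bool) \<Rightarrow> int" where
  "reps_offset c = fst (c 2) - fst (c 1)"

text \<open>The translation by \<open>p\<close> displaces the two components by \<open>p\<close> and
  \<open>-p\<close>; the reflection \<open>(p, True)\<close> displaces them by \<open>d - p\<close>
  and \<open>p - d\<close>, where \<open>d\<close> is the offset. Each displacement must be at most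
  one in absolute value.\<close>

lemma coordination_number_two_iff:
  assumes "coset_reps c"
  shows "coordination_number_two c S \<longleftrightarrow> S \<subseteq> hop_set (reps_offset c)"
proof -
  obtain m n where c: "c 1 = (m, False)" "c 2 = (n, True)"
    using assms by (rule coset_reps_cases)
  have "(\<forall>j. c (tau c h j) \<otimes>\<^bsub>D_inf\<^esub> h \<otimes>\<^bsub>D_inf\<^esub> inv\<^bsub>D_inf\<^esub> (c j)
        \<in> {\<one>\<^bsub>D_inf\<^esub>, gen_a, inv\<^bsub>D_inf\<^esub> gen_a}) \<longleftrightarrow> h \<in> hop_set (n - m)" for h
    unfolding forall_2
    by (cases h) (auto simp: tau_eq[OF assms] c inv_D_inf gen_a_def hop_set_def split: if_splits)
  then show ?thesis by (auto simp: coordination_number_two_def c reps_offset_def)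
qed

text \<open>Padding with zero amplitudes lets every admissible walk be treated as one on the full
  \<open>hop_set\<close>, with six possibly vanishing amplitudes.\<close>

lemma walk_op_extend:
  assumes "finite T" "S \<subseteq> T"
  shows "walk_op G S z = walk_op G T (\<lambda>h. if h \<in> S then z h else 0)"
  using assms
  by (auto simp: walk_op_def fun_eq_iff if_distrib[of "\<lambda>u. u * _"] sum.inter_restrict[symmetric]
      Int_absorb1 cong: if_cong)

section \<open>Coarse-grained operators and uniqueness of their symbols\<close>

definition cmat2 :: "complex \<Rightarrow> complex \<Rightarrow> complex \<Rightarrow> complex \<Rightarrow> complex^2^2" where
  "cmat2 a b c d = vector [vector [a, b], vector [c, d]]"

lemma cmat2_nth [simp]:
  "cmat2 a b c d $ 1 $ 1 = a" "cmat2 a b c d $ 1 $ 2 = b"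
  "cmat2 a b c d $ 2 $ 1 = c" "cmat2 a b c d $ 2 $ 2 = d"
  by (simp_all add: cmat2_def)

lemma right_reg_H_grp:
  "right_reg H_grp (n, False) \<psi> (k, b) = (if b then 0 else \<psi> (k + n, False))"
  by (simp add: right_reg_def H_grp_def H_sub_eq)

lemma inv_H_grp_gen_a: "inv\<^bsub>H_grp\<^esub> gen_a = (-1, False)"
proof -
  interpret group D_inf by (rule group_D_inf)
  have "subgroup H_sub D_inf" unfolding H_sub_def by (rule generate_is_subgroup) simp
  then have "inv\<^bsub>H_grp\<^esub> gen_a = inv\<^bsub>D_inf\<^esub> gen_a"
    unfolding H_grp_def by (rule m_inv_consistent) (simp add: H_sub_eq gen_a_def)
  then show ?thesis by (simp add: gen_a_def inv_D_inf)
qed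

definition hop_op ::
  "complex^2^2 \<Rightarrow> complex^2^2 \<Rightarrow> complex^2^2 \<Rightarrow> ((int \<times> bool) \<times> 2 \<Rightarrow> complex) \<Rightarrow> ((int \<times> bool) \<times> 2 \<Rightarrow> complex)"
  where "hop_op Ap Am Ae \<phi> = (\<lambda>p.
         tensor_op (right_reg H_grp gen_a) Ap \<phi> p
       + tensor_op (right_reg H_grp (inv\<^bsub>H_grp\<^esub> gen_a)) Am \<phi> p
       + tensor_op (right_reg H_grp \<one>\<^bsub>H_grp\<^esub>) Ae \<phi> p)"

lemma hop_op_apply:
  "hop_op Ap Am Ae \<phi> ((k, b), i) = (if b then 0 else
     Ap $ i $ 1 * \<phi> ((k + 1, False), 1) + Ap $ i $ 2 * \<phi> ((k + 1, False), 2)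
   + Am $ i $ 1 * \<phi> ((k - 1, False), 1) + Am $ i $ 2 * \<phi> ((k - 1, False), 2)
   + Ae $ i $ 1 * \<phi> ((k, False), 1) + Ae $ i $ 2 * \<phi> ((k, False), 2))"
  unfolding hop_op_def tensor_op_def inv_H_grp_gen_a
  by (simp add: gen_a_def H_grp_def[THEN arg_cong[where f = one]] right_reg_H_grp sum_2)

text \<open>The three terms send a ket in cell 0 to the cells -1, 1 and 0 respectively, so one
  column of each matrix can be read off there.\<close>

lemma hop_op_inject:
  assumes "\<And>\<phi>. \<phi> \<in> ell2 (H_sub \<times> UNIV) \<Longrightarrow> hop_op Ap Am Ae \<phi> = hop_op Bp Bm Be \<phi>"
  shows "Ap = Bp" "Am = Bm" "Ae = Be"
proof -
  have *: "hop_op Ap Am Ae (ket ((0, False), j)) ((k, False), i) =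
      hop_op Bp Bm Be (ket ((0, False), j)) ((k, False), i)" for j k i
    using assms[OF ket_in_ell2] by (simp add: H_sub_eq)
  show "Ap = Bp"
    using *[of 1 "-1"] *[of 2 "-1"] by (simp add: hop_op_apply vec_eq_iff forall_2 ket_def)
  show "Am = Bm"
    using *[of 1 1] *[of 2 1] by (simp add: hop_op_apply vec_eq_iff forall_2 ket_def)
  show "Ae = Be"
    using *[of 1 0] *[of 2 0] by (simp add: hop_op_apply vec_eq_iff forall_2 ket_def)
qed

text \<open>Translations act with opposite orientation on the two components. Hence the second
  matrix is the first conjugated by \<open>sigma_x\<close>, and the third commutes with
  \<open>sigma_x\<close>.\<close>

lemma coarse_graining_hop:
  assumes "coset_reps c" "d = reps_offset c"
  shows "coarse_graining c (walk_op D_inf (hop_set d) z) \<phi> =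
    hop_op (cmat2 (z (1, False)) (z (d + 1, True)) (z (d - 1, True)) (z (-1, False)))
           (cmat2 (z (-1, False)) (z (d - 1, True)) (z (d + 1, True)) (z (1, False)))
           (cmat2 (z (0, False)) (z (d, True)) (z (d, True)) (z (0, False))) \<phi>"
proof
  fix p :: "(int \<times> bool) \<times> 2"
  obtain m n where c: "c 1 = (m, False)" "c 2 = (n, True)"
    using assms by - (rule coset_reps_cases)
  have d: "d = n - m" using assms by (simp add: reps_offset_def c)
  obtain k b i where p: "p = ((k, b), i)" by (metis prod.collapse)
  have adj: "U_H_adj c \<phi> (l, e) = (if e then \<phi> ((l - n, False), 2) else \<phi> ((l - m, False), 1))" for l e
    by (simp add: U_H_adj_def sum_2 c inv_D_inf H_sub_eq)
  show "coarse_graining c (walk_op D_inf (hop_set d) z) \<phi> p =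
    hop_op (cmat2 (z (1, False)) (z (d + 1, True)) (z (d - 1, True)) (z (-1, False)))
           (cmat2 (z (-1, False)) (z (d - 1, True)) (z (d + 1, True)) (z (1, False)))
           (cmat2 (z (0, False)) (z (d, True)) (z (d, True)) (z (0, False))) \<phi> p"
    using exhaust_2[of i]
    by (elim disjE) (simp_all add: p coarse_graining_def U_H_def walk_op_def sum_hop_set right_reg_def
        adj c hop_op_apply H_sub_eq d)
qed

definition hop_symbol ::
  "complex \<Rightarrow> complex \<Rightarrow> complex \<Rightarrow> complex \<Rightarrow> complex \<Rightarrow> complex \<Rightarrow> real \<Rightarrow> complex^2^2" where
  "hop_symbol a b c p q r k = exp (- \<i> * of_real k) \<odot> cmat2 a p q b
     + exp (\<i> * of_real k) \<odot> cmat2 b q p a + cmat2 c r r c"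

text \<open>The three matrices are unique by \<open>hop_op_inject\<close>, so the existential in
  \<open>has_symbol\<close> becomes an equation.\<close>

lemma has_symbol_hop_iff:
  assumes "coset_reps c" "d = reps_offset c"
  shows "has_symbol (coarse_graining c (walk_op D_inf (hop_set d) z)) A \<longleftrightarrow>
    A = (\<lambda>k\<in>{-pi..pi}. hop_symbol (z (1, False)) (z (-1, False)) (z (0, False))
           (z (d + 1, True)) (z (d - 1, True)) (z (d, True)) k)"
  (is "?L = ?R")
proof
  assume ?L
  then obtain Ap Am Ae where *: "\<And>\<phi>. \<phi> \<in> ell2 (H_sub \<times> UNIV) \<Longrightarrow>
      coarse_graining c (walk_op D_inf (hop_set d) z) \<phi> = hop_op Ap Am Ae \<phi>"
    and A: "A = (\<lambda>k\<in>{-pi..pi}. exp (- \<i> * of_real k) \<odot> Ap + exp (\<i> * of_real k) \<odot> Am + Ae)"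
    unfolding has_symbol_def hop_op_def[symmetric] by blast
  show ?R
    unfolding A hop_symbol_def
    using hop_op_inject[OF trans[OF coarse_graining_hop[OF assms, symmetric] *]] by simp
next
  assume ?R
  then show ?L
    unfolding has_symbol_def hop_op_def[symmetric] coarse_graining_hop[OF assms] hop_symbol_def by blast
qed

section \<open>Unitarity as finitely many equations for six amplitudes\<close>

text \<open>With \<open>a, b, c\<close> the amplitudes of the translations by \<open>+1, -1, 0\<close> and \<open>p, q, r\<close> those of the
  corresponding reflections, the first eight equations are the coefficients of \<open>A\<^sup>\<dagger> A = 1\<close> and the
  remaining ones those of \<open>A A\<^sup>\<dagger> = 1\<close>, up to conjugates.\<close>

definition unitary_hops :: "complex \<Rightarrow> complex \<Rightarrow> complex \<Rightarrow> complex \<Rightarrow> complex \<Rightarrow> complex \<Rightarrow> bool" where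
  "unitary_hops a b c p q r \<longleftrightarrow>
     cnj a * a + cnj b * b + cnj c * c + cnj p * p + cnj q * q + cnj r * r = 1 \<and>
     cnj b * c + cnj c * a + cnj p * r + cnj r * q = 0 \<and>
     cnj b * a + cnj p * q = 0 \<and>
     cnj b * q + cnj c * r + cnj a * p + cnj q * b + cnj r * c + cnj p * a = 0 \<and>
     cnj b * r + cnj c * p + cnj r * b + cnj p * c = 0 \<and>
     cnj c * q + cnj a * r + cnj q * c + cnj r * a = 0 \<and>
     cnj b * p + cnj p * b = 0 \<and> cnj a * q + cnj q * a = 0 \<and>
     b * cnj c + c * cnj a + q * cnj r + r * cnj p = 0 \<and>
     b * cnj a + q * cnj p = 0 \<and>
     b * cnj p + c * cnj r + a * cnj q + q * cnj a + r * cnj c + p * cnj b = 0 \<and>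
     c * cnj p + a * cnj r + r * cnj a + p * cnj c = 0 \<and>
     b * cnj r + c * cnj q + q * cnj c + r * cnj b = 0 \<and>
     a * cnj p + p * cnj a = 0 \<and> b * cnj q + q * cnj b = 0"

text \<open>The equations are instances of the two coefficient identities at translations by 0, 1, 2
  and at reflections within distance two of \<open>d\<close>. Translations by -1 and -2 would only
  give conjugates.\<close>

lemma unitary_hopsD:
  assumes z: "\<And>h. h \<notin> hop_set d \<Longrightarrow> z h = 0"
    and U: "unitary_on_ell2 UNIV (walk_op D_inf (hop_set d) z)"
  shows "unitary_hops (z (1, False)) (z (-1, False)) (z (0, False))
           (z (d + 1, True)) (z (d - 1, True)) (z (d, True))"
proof -
  interpret group D_inf by (rule group_D_inf)
  have zF: "z (n, False) = 0" if "n \<notin> {-1, 0, 1}" for n using z that by (auto simp: hop_set_def)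
  have zT: "z (n, True) = 0" if "n \<notin> {d - 1, d, d + 1}" for n using z that by (auto simp: hop_set_def)
  have L: "(\<Sum>h\<in>hop_set d. cnj (z h) * z (h \<otimes>\<^bsub>D_inf\<^esub> y)) = (if y = (0, False) then 1 else 0)" for y
    using unitary_walk_op_left[where S = "hop_set d" and y = y and z = z, OF _ _ z] U by simp
  have R: "(\<Sum>h\<in>hop_set d. z h * cnj (z (y \<otimes>\<^bsub>D_inf\<^esub> h))) = (if y = (0, False) then 1 else 0)" for y
    using unitary_walk_op_right[where S = "hop_set d" and y = y and z = z, OF _ _ z] U by simp
  note [simp] = sum_hop_set zF zT
  show ?thesis
    unfolding unitary_hops_def
  proof (intro conjI, goal_cases)
    case 1
    show ?case using L[of "(0, False)"] by (simp add: ac_simps)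
  next
    case 2
    show ?case using L[of "(1, False)"] by (simp add: ac_simps)
  next
    case 3
    show ?case using L[of "(2, False)"] by (simp add: ac_simps)
  next
    case 4
    show ?case using L[of "(d, True)"] by (simp add: ac_simps)
  next
    case 5
    show ?case using L[of "(d + 1, True)"] by (simp add: ac_simps)
  next
    case 6
    show ?case using L[of "(d - 1, True)"] by (simp add: ac_simps)
  next
    case 7
    show ?case using L[of "(d + 2, True)"] by (simp add: ac_simps)
  next
    case 8
    show ?case using L[of "(d - 2, True)"] by (simp add: ac_simps)
  next
    case 9
    show ?case using R[of "(1, False)"] by (simp add: ac_simps)
  next
    case 10
    show ?case using R[of "(2, False)"] by (simp add: ac_simps)
  next
    case 11
    show ?case using R[of "(d, True)"] by (simp add: ac_simps)
  next
    case 12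
    show ?case using R[of "(d + 1, True)"] by (simp add: ac_simps)
  next
    case 13
    show ?case using R[of "(d - 1, True)"] by (simp add: ac_simps)
  next
    case 14
    show ?case using R[of "(d + 2, True)"] by (simp add: ac_simps)
  next
    case 15
    show ?case using R[of "(d - 2, True)"] by (simp add: ac_simps)
  qed
qed

lemma unitary_hopsI:
  assumes z: "\<And>h. h \<notin> hop_set d \<Longrightarrow> z h = 0"
    and U: "unitary_hops (z (1, False)) (z (-1, False)) (z (0, False))
           (z (d + 1, True)) (z (d - 1, True)) (z (d, True))"
  shows "unitary_on_ell2 UNIV (walk_op D_inf (hop_set d) z)"
proof -
  interpret group D_inf by (rule group_D_inf)
  have zF: "z (n, False) = 0" if "n \<notin> {-1, 0, 1}" for n using z that by (auto simp: hop_set_def)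
  have zT: "z (n, True) = 0" if "n \<notin> {d - 1, d, d + 1}" for n using z that by (auto simp: hop_set_def)
  show ?thesis
    using U unfolding unitary_hops_def
  proof (elim conjE, goal_cases)
    case E: 1
    \<comment> \<open>A quotient of two hops moves at most two cells, so the sums can be nonzero
      only in the first five cases; in the last two every summand vanishes.\<close>
    have far: "n = -2 \<or> n = -1 \<or> n = 0 \<or> n = 1 \<or> n = 2 \<or> n < -2 \<or> n > 2" for n :: int
      by linarith
    have LF: "(\<Sum>h\<in>hop_set d. cnj (z h) * z (h \<otimes>\<^bsub>D_inf\<^esub> (n, False))) = (if n = 0 then 1 else 0)" for n
      using far[of n]
    proof (elim disjE, goal_cases)
      case 1
      \<comment> \<open>The coefficient at a negative translation is the conjugate of that at the
        opposite one.\<close>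
      have "cnj (cnj (z (-1, False)) * z (1, False) + cnj (z (d + 1, True)) * z (d - 1, True)) = 0"
        using E by simp
      with 1 show ?case by (simp add: sum_hop_set zF zT ac_simps)
    next
      case 2
      have "cnj (cnj (z (-1, False)) * z (0, False) + cnj (z (0, False)) * z (1, False)
        + cnj (z (d + 1, True)) * z (d, True) + cnj (z (d, True)) * z (d - 1, True)) = 0"
        using E by simp
      with 2 show ?case by (simp add: sum_hop_set zF zT ac_simps)
    next
      case 3
      then show ?case using E by (simp add: sum_hop_set zF zT ac_simps)
    next
      case 4
      then show ?case using E by (simp add: sum_hop_set zF zT ac_simps)
    next
      case 5
      then show ?case using E by (simp add: sum_hop_set zF zT ac_simps)
    qed (simp_all add: sum_hop_set zF zT)
    have LT: "(\<Sum>h\<in>hop_set d. cnj (z h) * z (h \<otimes>\<^bsub>D_inf\<^esub> (d + n, True))) = 0" for n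
      using far[of n]
    proof (elim disjE, goal_cases)
      case 1
      then show ?case using E(8) by (simp add: sum_hop_set zF zT ac_simps)
    next
      case 2
      then show ?case using E(6) by (simp add: sum_hop_set zF zT ac_simps)
    next
      case 3
      then show ?case using E(4) by (simp add: sum_hop_set zF zT ac_simps)
    next
      case 4
      then show ?case using E(5) by (simp add: sum_hop_set zF zT ac_simps)
    next
      case 5
      then show ?case using E(7) by (simp add: sum_hop_set zF zT ac_simps)
    qed (simp_all add: sum_hop_set zF zT)
    have RF: "(\<Sum>h\<in>hop_set d. z h * cnj (z ((n, False) \<otimes>\<^bsub>D_inf\<^esub> h))) = (if n = 0 then 1 else 0)" for n
      using far[of n]
    proof (elim disjE, goal_cases)
      case 1
      have "cnj (z (-1, False) * cnj (z (1, False)) + z (d - 1, True) * cnj (z (d + 1, True))) = 0"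
        using E by simp
      with 1 show ?case by (simp add: sum_hop_set zF zT ac_simps)
    next
      case 2
      have "cnj (z (-1, False) * cnj (z (0, False)) + z (0, False) * cnj (z (1, False))
        + z (d - 1, True) * cnj (z (d, True)) + z (d, True) * cnj (z (d + 1, True))) = 0"
        using E by simp
      with 2 show ?case by (simp add: sum_hop_set zF zT ac_simps)
    next
      case 3
      then show ?case using E by (simp add: sum_hop_set zF zT ac_simps)
    next
      case 4
      then show ?case using E by (simp add: sum_hop_set zF zT ac_simps)
    next
      case 5
      then show ?case using E by (simp add: sum_hop_set zF zT ac_simps)
    qed (simp_all add: sum_hop_set zF zT)
    have RT: "(\<Sum>h\<in>hop_set d. z h * cnj (z ((d + n, True) \<otimes>\<^bsub>D_inf\<^esub> h))) = 0" for n
      using far[of n]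
    proof (elim disjE, goal_cases)
      case 1
      then show ?case using E(15) by (simp add: sum_hop_set zF zT ac_simps)
    next
      case 2
      then show ?case using E(13) by (simp add: sum_hop_set zF zT ac_simps)
    next
      case 3
      then show ?case using E(11) by (simp add: sum_hop_set zF zT ac_simps)
    next
      case 4
      then show ?case using E(12) by (simp add: sum_hop_set zF zT ac_simps)
    next
      case 5
      then show ?case using E(14) by (simp add: sum_hop_set zF zT ac_simps)
    qed (simp_all add: sum_hop_set zF zT)
    have "(\<Sum>h\<in>hop_set d. cnj (z h) * z (h \<otimes>\<^bsub>D_inf\<^esub> y)) = (if y = (0, False) then 1 else 0)"
      "(\<Sum>h\<in>hop_set d. z h * cnj (z (y \<otimes>\<^bsub>D_inf\<^esub> h))) = (if y = (0, False) then 1 else 0)" for y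
      using LF[of "fst y"] RF[of "fst y"] LT[of "fst y - d"] RT[of "fst y - d"]
      by (cases y; cases "snd y"; simp)+
    then show ?case
      using unitary_walk_opI[where S = "hop_set d" and z = z, OF _ _ z] by simp
  qed
qed

section \<open>Solving the unitarity equations\<close>

lemma polar_fixed_norm:
  assumes "cmod w = \<nu>"
  obtains t where "w = of_real \<nu> * exp (\<i> * of_real t)"
  using rcis_cmod_Arg[of w] assms by (metis rcis_def cis_conv_exp)

lemma Re_zero_iff: "Re (cnj u * v) = 0 \<longleftrightarrow> cnj u * v + cnj v * u = 0"
  by (auto simp: complex_eq_iff algebra_simps)

text \<open>The hypothesis is orthogonality of \<open>u\<close> and \<open>v\<close> in the real
  plane, so \<open>u + v\<close> and \<open>u - v\<close> are the diagonals of a possibly degenerate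
  rectangle.\<close>

lemma cmod_eq_of_Re:
  assumes "cnj u * v + cnj v * u = 0"
  shows "cmod (u + v) = cmod (u - v)"
proof -
  have "(cmod (u + v))\<^sup>2 = (cmod (u - v))\<^sup>2"
    using assms[folded Re_zero_iff] unfolding cmod_power2 by (simp add: power2_eq_square algebra_simps)
  then show ?thesis by (simp add: power2_eq_iff_nonneg)
qed

text \<open>Orthogonality makes \<open>cnj w * d\<close> purely imaginary; dividing by the squared
  modulus of \<open>w\<close> gives the real factor.\<close>

lemma imaginary_multiple:
  assumes "cnj w * d + cnj d * w = 0" "w \<noteq> 0"
  obtains m where "d = \<i> * of_real m * w"
proof
  have *: "cnj w * d = \<i> * of_real (Im (cnj w * d))"
    using assms(1)[folded Re_zero_iff] by (simp add: complex_eq_iff)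
  have "d * of_real ((cmod w)\<^sup>2) = w * (cnj w * d)"
    by (simp only: complex_norm_square ac_simps)
  then have "d * of_real ((cmod w)\<^sup>2) = w * (\<i> * of_real (Im (cnj w * d)))" unfolding *[symmetric] .
  then show "d = \<i> * of_real (Im (cnj w * d) / (cmod w)\<^sup>2) * w" using assms(2) by (simp add: field_simps)
qed

lemma exp_i_times_of_real: "exp (\<i> * of_real y) = of_real (cos y) + \<i> * of_real (sin y)"
  by (simp add: complex_eq_iff Re_exp Im_exp)

text \<open>In the eigenbasis of \<open>sigma_x\<close> the matrix of the amplitudes \<open>a, p, q, b\<close> has the entries
  \<open>s1, s2, s3, s4\<close> (up to a factor 2). The equations force them to have equal modulus and to
  satisfy \<open>s1 * s2 = s3 * s4\<close>, so that their three free phases give \<open>\<eta>\<close>, \<open>\<alpha>\<close> and \<open>\<beta>\<close>.\<close>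

lemma unitary_hops_parametrization:
  assumes U: "unitary_hops a b c p q r" and nz: "a \<noteq> 0 \<or> b \<noteq> 0 \<or> p \<noteq> 0 \<or> q \<noteq> 0"
  obtains \<eta> \<alpha> \<beta> \<nu> m :: real where
    "\<nu> > 0" "\<nu>\<^sup>2 + m\<^sup>2 = 1"
    "a = exp (\<i> * \<eta>) * \<nu> * cos \<alpha> * cos \<beta>"
    "b = - exp (\<i> * \<eta>) * \<nu> * sin \<alpha> * sin \<beta>"
    "p = \<i> * exp (\<i> * \<eta>) * \<nu> * cos \<alpha> * sin \<beta>"
    "q = \<i> * exp (\<i> * \<eta>) * \<nu> * sin \<alpha> * cos \<beta>"
    "c = - exp (\<i> * \<eta>) * m * sin (\<alpha> + \<beta>)"
    "r = \<i> * exp (\<i> * \<eta>) * m * cos (\<alpha> + \<beta>)"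
proof -
  note eqs = U[unfolded unitary_hops_def]
  define s1 where "s1 = a + b + p + q"
  define s2 where "s2 = a + b - p - q"
  define s3 where "s3 = a - b - p + q"
  define s4 where "s4 = a - b + p - q"
  define \<nu> where "\<nu> = cmod s1"
  have c1: "cnj b * a + cnj p * q = 0"
     "cnj b * p + cnj p * b = 0" "cnj a * q + cnj q * a = 0"
     "a * cnj p + p * cnj a = 0" "b * cnj q + q * cnj b = 0"
    using eqs by auto
  have c1': "b * cnj a + p * cnj q = 0"
    using arg_cong[OF c1(1), of cnj] by simp
  \<comment> \<open>The three equalities of moduli come from three orthogonal splittings:
    \<open>a + b\<close> against \<open>p + q\<close>, \<open>a - b\<close> against
    \<open>q - p\<close>, and \<open>a + q\<close> against \<open>b + p\<close>.\<close>
  have n12: "cmod s1 = cmod s2"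
  proof -
    have "cnj (a + b) * (p + q) + cnj (p + q) * (a + b) =
        (cnj b * p + cnj p * b) + (cnj a * q + cnj q * a) + (a * cnj p + p * cnj a) + (b * cnj q + q * cnj b)"
      by (simp add: algebra_simps)
    from cmod_eq_of_Re[OF this[unfolded c1 add_0_right diff_0_right]]
    show ?thesis by (simp add: s1_def s2_def algebra_simps)
  qed
  have n34: "cmod s3 = cmod s4"
  proof -
    have "cnj (a - b) * (q - p) + cnj (q - p) * (a - b) =
        (cnj b * p + cnj p * b) + (cnj a * q + cnj q * a) - (a * cnj p + p * cnj a) - (b * cnj q + q * cnj b)"
      by (simp add: algebra_simps)
    from cmod_eq_of_Re[OF this[unfolded c1 add_0_right diff_0_right]]
    show ?thesis by (simp add: s3_def s4_def algebra_simps)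
  qed
  have n13: "cmod s1 = cmod s3"
  proof -
    have "cnj (a + q) * (b + p) + cnj (b + p) * (a + q) =
        (cnj b * a + cnj p * q) + (b * cnj a + p * cnj q) + (a * cnj p + p * cnj a) + (b * cnj q + q * cnj b)"
      by (simp add: algebra_simps)
    from cmod_eq_of_Re[OF this[unfolded c1 c1' add_0_right]]
    show ?thesis by (simp add: s1_def s3_def algebra_simps)
  qed
  \<comment> \<open>This is the vanishing determinant of the hopping matrix with rows
    \<open>a, p\<close> and \<open>q, b\<close>.\<close>
  have det: "a * b = p * q"
  proof (cases "b = 0")
    case True
    then show ?thesis using c1 by auto
  next
    case False
    have "(a * b - p * q) * cnj b = b * (cnj b * a + cnj p * q) - q * (cnj b * p + cnj p * b)"
      by (simp add: algebra_simps)
    then show ?thesis using False unfolding c1 by simp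
  qed
  have prod: "s1 * s2 = s3 * s4"
  proof -
    have "s1 * s2 - s3 * s4 = 4 * (a * b - p * q)"
      by (simp add: s1_def s2_def s3_def s4_def algebra_simps)
    then show ?thesis using det by simp
  qed
  have sums: "4 * a = s1 + s2 + s3 + s4" "4 * b = s1 + s2 - s3 - s4"
      "4 * p = s1 - s2 - s3 + s4" "4 * q = s1 - s2 + s3 - s4"
    by (simp_all add: s1_def s2_def s3_def s4_def)
  have "\<nu> > 0"
  proof (rule ccontr)
    assume "\<not> \<nu> > 0"
    then have "s1 = 0" "s2 = 0" "s3 = 0" "s4 = 0" using n12 n34 n13 by (simp_all add: \<nu>_def)
    then show False using nz sums by simp
  qed
  obtain A where A: "s1 = of_real \<nu> * exp (\<i> * of_real A)"
    using polar_fixed_norm[of s1 \<nu>] \<nu>_def by blast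
  obtain B where B: "s2 = of_real \<nu> * exp (\<i> * of_real B)"
    using polar_fixed_norm[of s2 \<nu>] \<nu>_def n12 by auto
  obtain C where C: "s3 = of_real \<nu> * exp (\<i> * of_real C)"
    using polar_fixed_norm[of s3 \<nu>] \<nu>_def n13 by auto
  have D: "s4 = of_real \<nu> * exp (\<i> * of_real (A + B - C))"
  proof -
    have "exp (\<i> * of_real A) * exp (\<i> * of_real B) =
        exp (\<i> * of_real C) * exp (\<i> * of_real (A + B - C))"
      by (simp add: exp_add[symmetric] algebra_simps)
    then have "s3 * s4 = s3 * (of_real \<nu> * exp (\<i> * of_real (A + B - C)))"
      unfolding prod[symmetric] unfolding A B C by (simp add: ac_simps)
    moreover have "s3 \<noteq> 0" using \<open>\<nu> > 0\<close> by (simp add: C)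
    ultimately show ?thesis by simp
  qed
  \<comment> \<open>Solves for the four phases to be \<open>\<eta>\<close> plus or minus
    \<open>\<alpha> + \<beta>\<close> and \<open>\<eta>\<close> plus or minus
    \<open>\<alpha> - \<beta>\<close>; the relation \<open>s1 * s2 = s3 * s4\<close> makes this
    possible.\<close>
  define \<eta> where "\<eta> = (A + B) / 2"
  define \<alpha> where "\<alpha> = ((A - B) / 2 + (C - \<eta>)) / 2"
  define \<beta> where "\<beta> = ((A - B) / 2 - (C - \<eta>)) / 2"
  have ang: "A = \<eta> + (\<alpha> + \<beta>)" "B = \<eta> + - (\<alpha> + \<beta>)" "C = \<eta> + (\<alpha> - \<beta>)"
    "A + B - C = \<eta> + - (\<alpha> - \<beta>)"
    by (simp_all add: \<eta>_def \<alpha>_def \<beta>_def field_simps)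
  let ?E = "exp (\<i> * complex_of_real \<eta>)"
  have ex: "exp (\<i> * of_real (\<eta> + y)) = ?E * (of_real (cos y) + \<i> * of_real (sin y))" for y :: real
    unfolding exp_i_times_of_real[of y, symmetric] by (simp add: distrib_left exp_add)
  have s: "s1 = \<nu> * (?E * (cos (\<alpha> + \<beta>) + \<i> * sin (\<alpha> + \<beta>)))"
    "s2 = \<nu> * (?E * (cos (\<alpha> + \<beta>) - \<i> * sin (\<alpha> + \<beta>)))"
    "s3 = \<nu> * (?E * (cos (\<alpha> - \<beta>) + \<i> * sin (\<alpha> - \<beta>)))"
    "s4 = \<nu> * (?E * (cos (\<alpha> - \<beta>) - \<i> * sin (\<alpha> - \<beta>)))"
    unfolding A B C D[unfolded ang(4)] unfolding ang(1-3) ex cos_minus sin_minus by simp_all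
  \<comment> \<open>\<open>d1\<close> and \<open>d2\<close> are the eigenvalues of the on-site
    matrix with rows \<open>c, r\<close> and \<open>r, c\<close>, on the eigenvectors (1, 1) and (1,
    -1) of \<open>sigma_x\<close>.\<close>
  define d1 where "d1 = c + r"
  define d2 where "d2 = c - r"
  have c2: "cnj b * c + cnj c * a + cnj p * r + cnj r * q = 0"
     "cnj b * r + cnj c * p + cnj r * b + cnj p * c = 0"
     "cnj c * q + cnj a * r + cnj q * c + cnj r * a = 0"
    using eqs by auto
  have c2': "cnj c * b + cnj a * c + cnj r * p + cnj q * r = 0"
    using arg_cong[OF c2(1), of cnj] by (simp add: ac_simps)
  have "cnj s1 * d1 + cnj d1 * s1 =
      (cnj b * c + cnj c * a + cnj p * r + cnj r * q) + (cnj c * b + cnj a * c + cnj r * p + cnj q * r)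
    + (cnj b * r + cnj c * p + cnj r * b + cnj p * c) + (cnj c * q + cnj a * r + cnj q * c + cnj r * a)"
    by (simp add: s1_def d1_def algebra_simps)
  from this[unfolded c2 c2', simplified] obtain m where m: "d1 = \<i> * of_real m * s1"
    using \<open>\<nu> > 0\<close> by (rule_tac imaginary_multiple[of s1 d1]) (auto simp: \<nu>_def)
  have "cnj s2 * d2 + cnj d2 * s2 =
      (cnj b * c + cnj c * a + cnj p * r + cnj r * q) + (cnj c * b + cnj a * c + cnj r * p + cnj q * r)
    - (cnj b * r + cnj c * p + cnj r * b + cnj p * c) - (cnj c * q + cnj a * r + cnj q * c + cnj r * a)"
    by (simp add: s2_def d2_def algebra_simps)
  from this[unfolded c2 c2', simplified] obtain m2 where m2: "d2 = \<i> * of_real m2 * s2"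
    using \<open>\<nu> > 0\<close> n12 by (rule_tac imaginary_multiple[of s2 d2]) (auto simp: \<nu>_def)
  \<comment> \<open>The remaining combination links the two real factors: equal moduli and the phase
    relation give \<open>cnj s4 * s2 = cnj s1 * s3\<close>, which is nonzero, so
    \<open>m2 = - m\<close>.\<close>
  have "cnj s4 * d2 - cnj d1 * s3 =
    - (cnj b * c + cnj c * a + cnj p * r + cnj r * q) + (cnj c * b + cnj a * c + cnj r * p + cnj q * r)
    + (cnj b * r + cnj c * p + cnj r * b + cnj p * c) - (cnj c * q + cnj a * r + cnj q * c + cnj r * a)"
    by (simp add: s3_def s4_def d1_def d2_def algebra_simps)
  from this[unfolded c2 c2', simplified]
  have "\<i> * (of_real m2 * (cnj s4 * s2)) = \<i> * (- of_real m * (cnj s1 * s3))"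
    by (simp add: m m2 ac_simps)
  then have "of_real m2 * (cnj s4 * s2) = - of_real m * (cnj s1 * s3)"
    unfolding mult_left_cancel[OF complex_i_not_zero] .
  moreover have "cnj s4 * s2 = cnj s1 * s3"
    unfolding D unfolding A B C
    by (simp add: exp_cnj) (simp add: exp_add[symmetric] algebra_simps)
  moreover have "cnj s1 * s3 \<noteq> 0" using \<open>\<nu> > 0\<close> by (simp add: A C)
  ultimately have mm: "m2 = - m" by (simp flip: of_real_minus)
  \<comment> \<open>Normalization in the variables \<open>s1, ..., s4, d1, d2\<close>. Since
    \<open>d1\<close> has modulus \<open>\<nu>\<close> times that of \<open>m\<close>, the real
    parameter to be exported is \<open>\<nu> * m\<close>.\<close>
  have "complex_of_real 1 = of_real (\<nu>\<^sup>2 + (\<nu> * m)\<^sup>2)"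
  proof -
    have sq: "cnj s1 * s1 = of_real (\<nu>\<^sup>2)" "cnj s2 * s2 = of_real (\<nu>\<^sup>2)"
      "cnj s3 * s3 = of_real (\<nu>\<^sup>2)" "cnj s4 * s4 = of_real (\<nu>\<^sup>2)"
      using n12 n13 n34 unfolding \<nu>_def complex_norm_square by (simp_all only: ac_simps complex_norm_square[symmetric])
    have cancel4: "x + x + x + x + 2 * (y + y) = 4 \<Longrightarrow> x + y = 1" for x y :: complex
      by (simp add: complex_eq_iff)
    have "cnj s1 * s1 + cnj s2 * s2 + cnj s3 * s3 + cnj s4 * s4 + 2 * (cnj d1 * d1 + cnj d2 * d2) =
      4 * (cnj a * a + cnj b * b + cnj c * c + cnj p * p + cnj q * q + cnj r * r)"
      by (simp add: s1_def s2_def s3_def s4_def d1_def d2_def algebra_simps)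
    also have "\<dots> = 4" using eqs by simp
    also have "cnj d1 * d1 = of_real (m\<^sup>2) * (cnj s1 * s1)" by (simp add: m power2_eq_square algebra_simps)
    also have "cnj d2 * d2 = of_real (m\<^sup>2) * (cnj s2 * s2)" by (simp add: m2 mm power2_eq_square algebra_simps)
    finally have "complex_of_real (\<nu>\<^sup>2) + of_real (m\<^sup>2) * of_real (\<nu>\<^sup>2) = 1"
      unfolding sq by (intro cancel4)
    then show ?thesis by (simp add: power_mult_distrib ac_simps)
  qed
  then have norm: "\<nu>\<^sup>2 + (\<nu> * m)\<^sup>2 = 1" by (metis of_real_eq_iff)
  note expand = cos_add sin_add cos_diff sin_diff of_real_add of_real_diff of_real_mult
  have halve: "x = y" if "2 * x = 2 * y" for x y :: complex using that by simp
  have quarter: "x = y" if "4 * x = 4 * y" for x y :: complex using that by simp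
  have c: "2 * c = d1 + d2" and r: "2 * r = d1 - d2" by (simp_all add: d1_def d2_def)
  have cr: "c = - ?E * (\<nu> * m) * sin (\<alpha> + \<beta>)"
    by (rule halve, unfold c m m2 mm s of_real_minus of_real_mult) (use i_squared in algebra)
  have cr': "r = \<i> * ?E * (\<nu> * m) * cos (\<alpha> + \<beta>)"
    by (rule halve, unfold r m m2 mm s of_real_minus of_real_mult) algebra
  have abpq: "a = ?E * \<nu> * cos \<alpha> * cos \<beta>" "b = - ?E * \<nu> * sin \<alpha> * sin \<beta>"
    "p = \<i> * ?E * \<nu> * cos \<alpha> * sin \<beta>" "q = \<i> * ?E * \<nu> * sin \<alpha> * cos \<beta>"
    by (rule quarter, unfold sums s expand, algebra)+
  show thesis using that[OF \<open>\<nu> > 0\<close> norm abpq cr cr'] .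
qed

text \<open>Every equation is built from products of one amplitude with the conjugate of another, in
  which a common phase cancels.\<close>

lemma unitary_hops_scale:
  assumes E: "cnj e * e = 1" and U: "unitary_hops a b c p q r"
  shows "unitary_hops (e * a) (e * b) (e * c) (e * p) (e * q) (e * r)"
proof -
  have *: "cnj (e * x) * (e * y) = cnj x * y" "(e * x) * cnj (e * y) = x * cnj y" for x y
  proof -
    have "cnj (e * x) * (e * y) = (cnj e * e) * (cnj x * y)" "(e * x) * cnj (e * y) = (cnj e * e) * (x * cnj y)"
      by simp_all
    then show "cnj (e * x) * (e * y) = cnj x * y" "(e * x) * cnj (e * y) = x * cnj y"
      unfolding E by simp_all
  qed
  show ?thesis using U unfolding unitary_hops_def * .
qed

text \<open>The normalization factors through the Pythagorean identities; the other equations become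
  polynomial identities once the functions of \<open>\<alpha> + \<beta>\<close> are
  expanded.\<close>

lemma unitary_hops_of_angles:
  assumes "\<nu>\<^sup>2 + m\<^sup>2 = (1::real)"
  shows "unitary_hops (\<nu> * cos \<alpha> * cos \<beta>) (- \<nu> * sin \<alpha> * sin \<beta>) (- m * sin (\<alpha> + \<beta>))
    (\<i> * \<nu> * cos \<alpha> * sin \<beta>) (\<i> * \<nu> * sin \<alpha> * cos \<beta>) (\<i> * m * cos (\<alpha> + \<beta>))"
proof -
  have "(\<nu> * cos \<alpha> * cos \<beta>)\<^sup>2 + (\<nu> * sin \<alpha> * sin \<beta>)\<^sup>2 + (m * sin (\<alpha> + \<beta>))\<^sup>2
      + (\<nu> * cos \<alpha> * sin \<beta>)\<^sup>2 + (\<nu> * sin \<alpha> * cos \<beta>)\<^sup>2 + (m * cos (\<alpha> + \<beta>))\<^sup>2 =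
    \<nu>\<^sup>2 * ((sin \<alpha>)\<^sup>2 + (cos \<alpha>)\<^sup>2) * ((sin \<beta>)\<^sup>2 + (cos \<beta>)\<^sup>2) + m\<^sup>2 * ((sin (\<alpha> + \<beta>))\<^sup>2 + (cos (\<alpha> + \<beta>))\<^sup>2)"
    by (simp only: power_mult_distrib algebra_simps)
  also have "\<dots> = 1" using assms by simp
  finally have norm: "(\<nu> * cos \<alpha> * cos \<beta>)\<^sup>2 + (\<nu> * sin \<alpha> * sin \<beta>)\<^sup>2 + (m * sin (\<alpha> + \<beta>))\<^sup>2
      + (\<nu> * cos \<alpha> * sin \<beta>)\<^sup>2 + (\<nu> * sin \<alpha> * cos \<beta>)\<^sup>2 + (m * cos (\<alpha> + \<beta>))\<^sup>2 = 1" .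
  show ?thesis
    unfolding unitary_hops_def
  proof (intro conjI, goal_cases)
    case 1
    show ?case using norm by (simp add: complex_eq_iff power2_eq_square ac_simps)
  qed (simp_all add: complex_eq_iff cos_add sin_add algebra_simps)
qed

section \<open>Symbols and changes of basis\<close>

definition rot :: "real \<Rightarrow> complex^2^2" where
  "rot t = mexp ((\<i> * of_real t) \<odot> sigma_x)"

lemma rot_eq: "rot t = cmat2 (cos t) (\<i> * sin t) (\<i> * sin t) (cos t)"
  by (simp add: rot_def mexp_sigma_x cmat2_def)

lemma cmat2_mult:
  "cmat2 a b c d ** cmat2 a' b' c' d' =
    cmat2 (a * a' + b * c') (a * b' + b * d') (c * a' + d * c') (c * b' + d * d')"
  by (simp add: vec_eq_iff forall_2 matrix_matrix_mult_def sum_2)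

lemma cscale_cmat2: "e \<odot> cmat2 a b c d = cmat2 (e * a) (e * b) (e * c) (e * d)"
  by (simp add: vec_eq_iff forall_2 cscale_def)

lemma cmat2_add: "cmat2 a b c d + cmat2 a' b' c' d' = cmat2 (a + a') (b + b') (c + c') (d + d')"
  by (simp add: vec_eq_iff forall_2)

lemma cscale_mult_left: "(e \<odot> M) ** N = e \<odot> (M ** N)"
  by (simp add: vec_eq_iff forall_2 cscale_def matrix_matrix_mult_def sum_2 algebra_simps)

lemma cscale_mult_right: "M ** (e \<odot> N) = e \<odot> (M ** N)"
  by (simp add: vec_eq_iff forall_2 cscale_def matrix_matrix_mult_def sum_2 algebra_simps)

lemma cscale_cscale: "e \<odot> f \<odot> M = (e * f) \<odot> M"
  by (simp add: vec_eq_iff forall_2 cscale_def)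

lemma rot_add: "rot x ** rot y = rot (x + y)"
  by (simp add: rot_eq cmat2_mult cos_add sin_add algebra_simps)

lemma adj_rot: "adj (rot x) = rot (- x)"
  by (simp add: rot_eq vec_eq_iff forall_2 adj_def)

lemma unitary_rot: "unitary_matrix (rot x)"
  by (simp add: unitary_matrix_def adj_rot rot_add)
    (simp add: rot_eq vec_eq_iff forall_2 mat_def)

lemma adj_mult: "adj (M ** N) = adj N ** adj M"
  by (simp add: vec_eq_iff forall_2 adj_def matrix_matrix_mult_def sum_2 algebra_simps)

lemma unitary_mult:
  assumes "unitary_matrix U" "unitary_matrix V"
  shows "unitary_matrix (U ** V)"
  using assms unfolding unitary_matrix_def adj_mult
  by (metis matrix_mul_assoc matrix_mul_lid)

text \<open>A shift by \<pi> only changes the sign. It is written as an exponential so that it can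
  join the global phase.\<close>

lemma rot_int_pi: "rot (x + of_int n * pi) = exp (\<i> * of_real (of_int n * pi)) \<odot> rot x"
proof -
  have "sin (of_int n * pi) = 0" by (simp add: sin_zero_iff_int2)
  then show ?thesis
    by (simp only: exp_i_times_of_real) (simp add: rot_eq cscale_cmat2 cos_add sin_add ac_simps)
qed

text \<open>Conjugating by \<open>rot \<phi>\<close> changes the two angles in opposite directions, so that only their sum
  modulo \<open>\<pi>\<close> matters; this is what allows the angles to be moved off the multiples of \<open>\<pi>/2\<close>.\<close>

lemma shift_angles:
  obtains \<theta> \<theta>' \<phi> \<zeta> :: real where
    "\<theta> \<in> {-pi/2<..<0} \<union> {0<..<pi/2}" "\<theta>' \<in> {-pi/2<..<0} \<union> {0<..<pi/2}"
    "\<And>M. rot \<alpha> ** M ** rot \<beta> = exp (\<i> * of_real \<zeta>) \<odot> (rot \<phi> ** rot \<theta> ** M ** rot \<theta>' ** adj (rot \<phi>))"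
proof -
  define n where "n = \<lfloor>(\<alpha> + \<beta>) / pi\<rfloor>"
  define t where "t = \<alpha> + \<beta> - of_int n * pi"
  have "of_int n \<le> (\<alpha> + \<beta>) / pi" "(\<alpha> + \<beta>) / pi < of_int n + 1" unfolding n_def by linarith+
  then have t: "0 \<le> t" "t < pi" by (simp_all add: t_def field_simps)
  \<comment> \<open>Halving \<open>t\<close> stays strictly between 0 and \<pi>/2 unless
    \<open>t = 0\<close>, where two opposite nonzero angles serve.\<close>
  obtain \<theta> \<theta>' where th: "\<theta> \<in> {-pi/2<..<0} \<union> {0<..<pi/2}" "\<theta>' \<in> {-pi/2<..<0} \<union> {0<..<pi/2}" "\<theta> + \<theta>' = t"
  proof (cases "t = 0")
    case True
    show thesis by (rule that[of "pi/4" "-pi/4"]) (use True pi_gt_zero in auto)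
  next
    case False
    show thesis by (rule that[of "t/2" "t/2"]) (use False t in auto)
  qed
  define \<phi> where "\<phi> = \<alpha> - \<theta>"
  have ab: "\<alpha> = \<phi> + \<theta>" "\<beta> = \<theta>' + - \<phi> + of_int n * pi"
    using th(3) by (simp_all add: \<phi>_def t_def)
  have rb: "rot \<beta> = exp (\<i> * of_real (of_int n * pi)) \<odot> (rot \<theta>' ** adj (rot \<phi>))"
    unfolding adj_rot rot_add rot_int_pi[symmetric] ab(2) ..
  have ra: "rot \<alpha> = rot \<phi> ** rot \<theta>" unfolding rot_add ab(1) ..
  show thesis
  proof (rule that[OF th(1,2)])
    fix M :: "complex^2^2"
    show "rot \<alpha> ** M ** rot \<beta> =
        exp (\<i> * of_real (of_int n * pi)) \<odot> (rot \<phi> ** rot \<theta> ** M ** rot \<theta>' ** adj (rot \<phi>))"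
      unfolding ra rb by (simp add: cscale_mult_right matrix_mul_assoc)
  qed
qed

text \<open>The two diagonal entries of \<open>A_D\<close> give rank-one products with a column of
  \<open>rot \<alpha>\<close> and a row of \<open>rot \<beta>\<close>. The off-diagonal part is a
  multiple of \<open>sigma_x\<close>, which commutes with rotations, so it depends only on
  \<open>\<alpha> + \<beta>\<close>.\<close>

lemma hop_symbol_of_angles:
  fixes \<eta> \<alpha> \<beta> \<nu> \<mu> s k :: real
  shows "hop_symbol (exp (\<i> * \<eta>) * \<nu> * cos \<alpha> * cos \<beta>) (- exp (\<i> * \<eta>) * \<nu> * sin \<alpha> * sin \<beta>)
      (- exp (\<i> * \<eta>) * (s * \<mu>) * sin (\<alpha> + \<beta>))
      (\<i> * exp (\<i> * \<eta>) * \<nu> * cos \<alpha> * sin \<beta>) (\<i> * exp (\<i> * \<eta>) * \<nu> * sin \<alpha> * cos \<beta>)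
      (\<i> * exp (\<i> * \<eta>) * (s * \<mu>) * cos (\<alpha> + \<beta>)) k =
    exp (\<i> * of_real \<eta>) \<odot> (rot \<alpha> ** A_D \<nu> \<mu> s k ** rot \<beta>)"
proof -
  have AD: "A_D \<nu> \<mu> s k = cmat2 (of_real \<nu> * exp (- \<i> * of_real k)) (\<i> * of_real s * of_real \<mu>)
      (\<i> * of_real s * of_real \<mu>) (of_real \<nu> * exp (\<i> * of_real k))"
    by (simp add: A_D_def cmat2_def)
  show ?thesis
    unfolding hop_symbol_def AD rot_eq cmat2_mult cscale_cmat2 cmat2_add
    \<comment> \<open>Reduces equality of the two matrices to equality of their four
      entries.\<close>
    by (rule arg_cong[where f = "\<lambda>(a, b, c, d). cmat2 a b c d", of "(_, _, _, _)" "(_, _, _, _)", simplified])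
      (simp add: cos_add sin_add algebra_simps)
qed

section \<open>Characterization of the coarse-grained walks\<close>

lemma generate_D_inf_UNIV:
  assumes "(1, False) \<in> S" "(n, True) \<in> S"
  shows "generate D_inf S = UNIV"
proof -
  interpret group D_inf by (rule group_D_inf)
  have H: "(k, False) \<in> generate D_inf S" for k
  proof -
    have "H_sub \<subseteq> generate D_inf S"
      unfolding H_sub_def by (rule mono_generate) (use assms in \<open>simp add: gen_a_def\<close>)
    then show ?thesis by (auto simp: H_sub_eq)
  qed
  moreover have "(k, True) \<in> generate D_inf S" for k
    using generate.eng[OF H[of "k - n"] generate.incl[OF assms(2)]] by simp
  ultimately show ?thesis by (metis (full_types) UNIV_eq_I surj_pair)
qed

text \<open>Every reflection is an involution, so \<open>{(0, False), (d, True)}\<close> is a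
  subgroup of order two. This excludes walks without any displacement.\<close>

lemma generate_D_inf_proper:
  assumes "S \<subseteq> {(0, False), (d, True)}"
  shows "generate D_inf S \<noteq> UNIV"
proof -
  interpret group D_inf by (rule group_D_inf)
  have "subgroup {(0, False), (d, True)} D_inf"
    by unfold_locales (auto simp: inv_D_inf)
  then have "generate D_inf S \<subseteq> {(0, False), (d, True)}"
    using generate_subgroup_incl assms by blast
  moreover have "(1, False) \<notin> {(0, False), (d, True)}" by simp
  ultimately show ?thesis by blast
qed

text \<open>Unitarity gives the amplitudes their angular form. The rotation that corrects the angles
  is absorbed into the change of basis, and the phase it leaves into \<open>\<eta>\<close>.\<close>

lemma W_CG_subset:
  assumes "f \<in> W_CG"
  obtains \<eta> \<theta> \<theta>' \<nu> \<mu> s :: real and U where "unitary_matrix U"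
    "\<theta> \<in> {-pi/2<..<0} \<union> {0<..<pi/2}" "\<theta>' \<in> {-pi/2<..<0} \<union> {0<..<pi/2}"
    "\<nu> \<in> {0<..1}" "\<mu> \<in> {0..<1}" "\<nu>\<^sup>2 + \<mu>\<^sup>2 = 1" "s \<in> {1, -1}"
    "f = (\<lambda>k\<in>{-pi..pi}. exp (\<i> * of_real \<eta>) \<odot> (U ** rot \<theta> ** A_D \<nu> \<mu> s k ** rot \<theta>' ** adj U))"
proof -
  obtain U A S z c where f: "f = (\<lambda>k\<in>{-pi..pi}. U ** A k ** adj U)" and U: "unitary_matrix U"
    and w: "scalar_quantum_walk D_inf S z" and c: "coset_reps c" and S: "coordination_number_two c S"
    and A: "has_symbol (coarse_graining c (walk_op D_inf S z)) A"
    using assms unfolding W_CG_def mem_Collect_eq by (elim exE conjE)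
  define d where "d = reps_offset c"
  define Z where "Z = (\<lambda>h. if h \<in> S then z h else 0)"
  have Sd: "S \<subseteq> hop_set d" using S coordination_number_two_iff[OF c] by (simp add: d_def)
  have walk: "walk_op D_inf S z = walk_op D_inf (hop_set d) Z"
    unfolding Z_def by (rule walk_op_extend[OF finite_hop_set Sd])
  have hops: "unitary_hops (Z (1, False)) (Z (-1, False)) (Z (0, False))
           (Z (d + 1, True)) (Z (d - 1, True)) (Z (d, True))"
  proof (rule unitary_hopsD[of d Z])
    show "Z h = 0" if "h \<notin> hop_set d" for h using that Sd by (auto simp: Z_def)
    show "unitary_on_ell2 UNIV (walk_op D_inf (hop_set d) Z)"
      using w unfolding scalar_quantum_walk_def walk by simp
  qed
  have nz: "Z (1, False) \<noteq> 0 \<or> Z (-1, False) \<noteq> 0 \<or> Z (d + 1, True) \<noteq> 0 \<or> Z (d - 1, True) \<noteq> 0"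
  proof (rule ccontr)
    assume "\<not> ?thesis"
    moreover have "Z h \<noteq> 0" if "h \<in> S" for h using w that by (simp add: Z_def scalar_quantum_walk_def)
    ultimately have "S \<subseteq> {(0, False), (d, True)}" using Sd by (auto simp: hop_set_def)
    from generate_D_inf_proper[OF this] show False using w by (simp add: scalar_quantum_walk_def)
  qed
  have A_eq: "A = (\<lambda>k\<in>{-pi..pi}. hop_symbol (Z (1, False)) (Z (-1, False)) (Z (0, False))
           (Z (d + 1, True)) (Z (d - 1, True)) (Z (d, True)) k)"
    using A unfolding walk has_symbol_hop_iff[OF c d_def] .
  obtain \<eta> \<alpha> \<beta> \<nu> m :: real where \<nu>: "\<nu> > 0" and norm: "\<nu>\<^sup>2 + m\<^sup>2 = 1"
    and coeffs: "Z (1, False) = exp (\<i> * \<eta>) * \<nu> * cos \<alpha> * cos \<beta>"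
    "Z (-1, False) = - exp (\<i> * \<eta>) * \<nu> * sin \<alpha> * sin \<beta>"
    "Z (d + 1, True) = \<i> * exp (\<i> * \<eta>) * \<nu> * cos \<alpha> * sin \<beta>"
    "Z (d - 1, True) = \<i> * exp (\<i> * \<eta>) * \<nu> * sin \<alpha> * cos \<beta>"
    "Z (0, False) = - exp (\<i> * \<eta>) * m * sin (\<alpha> + \<beta>)"
    "Z (d, True) = \<i> * exp (\<i> * \<eta>) * m * cos (\<alpha> + \<beta>)"
    by (rule unitary_hops_parametrization[OF hops nz])
  \<comment> \<open>Splits the real parameter \<open>m\<close> into sign and modulus; the sign is 1
    by default when \<open>m = 0\<close>.\<close>
  define s :: real where "s = (if m < 0 then -1 else 1)"
  define \<mu> where "\<mu> = \<bar>m\<bar>"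
  have m: "m = s * \<mu>" and s: "s \<in> {1, -1}" and norm': "\<nu>\<^sup>2 + \<mu>\<^sup>2 = 1"
    using norm by (simp_all add: s_def \<mu>_def)
  have "\<nu>\<^sup>2 \<le> 1\<^sup>2" "\<mu>\<^sup>2 < 1\<^sup>2"
    unfolding one_power2 using norm' zero_le_power2[of \<mu>] zero_less_power[OF \<nu>, of 2] by linarith+
  then have \<nu>1: "\<nu> \<in> {0<..1}" and \<mu>1: "\<mu> \<in> {0..<1}"
    using \<nu> power2_le_imp_le[of \<nu> 1] power2_less_imp_less[of \<mu> 1]
    unfolding greaterThanAtMost_iff atLeastLessThan_iff by (simp_all only: \<mu>_def zero_le_one abs_ge_zero)
  obtain \<theta> \<theta>' \<phi> \<zeta> :: real where th: "\<theta> \<in> {-pi/2<..<0} \<union> {0<..<pi/2}" "\<theta>' \<in> {-pi/2<..<0} \<union> {0<..<pi/2}"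
    and shift: "\<And>M. rot \<alpha> ** M ** rot \<beta> =
      exp (\<i> * of_real \<zeta>) \<odot> (rot \<phi> ** rot \<theta> ** M ** rot \<theta>' ** adj (rot \<phi>))"
    by (rule shift_angles[of \<alpha> \<beta>]) (rule that)
  show thesis
  proof (rule that[OF unitary_mult[OF U unitary_rot[of \<phi>]] th \<nu>1 \<mu>1 norm' s, of "\<eta> + \<zeta>"])
    have "A k = exp (\<i> * of_real \<eta>) \<odot> (rot \<alpha> ** A_D \<nu> \<mu> s k ** rot \<beta>)" if "k \<in> {-pi..pi}" for k
      unfolding A_eq restrict_apply if_P[OF that] coeffs m of_real_mult
      by (rule hop_symbol_of_angles[unfolded of_real_mult])
    then show "f = (\<lambda>k\<in>{-pi..pi}. exp (\<i> * of_real (\<eta> + \<zeta>)) \<odot>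
        (U ** rot \<phi> ** rot \<theta> ** A_D \<nu> \<mu> s k ** rot \<theta>' ** adj (U ** rot \<phi>)))"
      unfolding f
      by (intro restrict_ext) (simp only: shift adj_mult cscale_cscale cscale_mult_left cscale_mult_right
          matrix_mul_assoc exp_add distrib_left of_real_add)
  qed
qed

text \<open>A walk with the required symbol is read off from \<open>hop_symbol_of_angles\<close> at
  the given angles, so only the change of basis \<open>U\<close> remains to be applied.\<close>

lemma W_CG_supset:
  fixes \<eta> \<theta> \<theta>' \<nu> \<mu> s :: real
  assumes U: "unitary_matrix U"
    and th: "\<theta> \<in> {-pi/2<..<0} \<union> {0<..<pi/2}" "\<theta>' \<in> {-pi/2<..<0} \<union> {0<..<pi/2}"
    and \<nu>: "\<nu> \<noteq> 0" and norm: "\<nu>\<^sup>2 + \<mu>\<^sup>2 = 1" and s: "s \<in> {1, -1}"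
  shows "(\<lambda>k\<in>{-pi..pi}. exp (\<i> * of_real \<eta>) \<odot> (U ** rot \<theta> ** A_D \<nu> \<mu> s k ** rot \<theta>' ** adj U)) \<in> W_CG"
proof -
  let ?E = "exp (\<i> * complex_of_real \<eta>)"
  define Z :: "int \<times> bool \<Rightarrow> complex" where "Z = (\<lambda>h.
     if h = (1, False) then ?E * \<nu> * cos \<theta> * cos \<theta>'
     else if h = (-1, False) then - ?E * \<nu> * sin \<theta> * sin \<theta>'
     else if h = (0, False) then - ?E * (s * \<mu>) * sin (\<theta> + \<theta>')
     else if h = (1, True) then \<i> * ?E * \<nu> * cos \<theta> * sin \<theta>'
     else if h = (-1, True) then \<i> * ?E * \<nu> * sin \<theta> * cos \<theta>'
     else if h = (0, True) then \<i> * ?E * (s * \<mu>) * cos (\<theta> + \<theta>')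
     else 0)"
  \<comment> \<open>The representatives are the identity and \<open>gen_r\<close>, with offset
    0.\<close>
  define c :: "2 \<Rightarrow> int \<times> bool" where "c = (\<lambda>j. (0, j = 2))"
  \<comment> \<open>Cutting down to the support meets the demand for nonzero amplitudes; the on-site
    ones vanish, for example, when \<open>\<mu> = 0\<close>.\<close>
  define S where "S = {h \<in> hop_set 0. Z h \<noteq> 0}"
  have c: "coset_reps c" by (auto simp: coset_reps_def c_def H_sub_eq r_coset_def gen_r_def)
  have off: "0 = reps_offset c" by (simp add: reps_offset_def c_def)
  have Z0: "Z h = 0" if "h \<notin> hop_set 0" for h using that by (auto simp: Z_def hop_set_def)
  have "(\<lambda>h. if h \<in> S then Z h else 0) = Z"
    using Z0 unfolding S_def by fastforce
  then have walk: "walk_op D_inf S Z = walk_op D_inf (hop_set 0) Z"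
    using walk_op_extend[of "hop_set 0" S D_inf Z] by (auto simp: S_def)
  have nz: "cos \<theta> \<noteq> 0" "cos \<theta>' \<noteq> 0" "sin \<theta>' \<noteq> 0"
    using th cos_gt_zero_pi[of \<theta>] cos_gt_zero_pi[of \<theta>'] sin_gt_zero[of \<theta>'] sin_gt_zero[of "- \<theta>'"] by auto
  have "(s * \<mu>)\<^sup>2 = \<mu>\<^sup>2" using s by (auto simp: power_mult_distrib)
  then have norm': "\<nu>\<^sup>2 + (s * \<mu>)\<^sup>2 = 1" using norm by simp
  have E: "cnj ?E * ?E = 1" by (simp add: exp_cnj exp_add[symmetric])
  have "unitary_hops (Z (1, False)) (Z (-1, False)) (Z (0, False)) (Z (0 + 1, True)) (Z (0 - 1, True)) (Z (0, True))"
    using unitary_hops_scale[OF E unitary_hops_of_angles[OF norm', of \<theta> \<theta>']] by (simp add: Z_def ac_simps)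
  then have "unitary_on_ell2 UNIV (walk_op D_inf (hop_set 0) Z)"
    using unitary_hopsI[of 0 Z] Z0 by blast
  \<comment> \<open>The angle ranges keep the amplitudes at \<open>(1, False)\<close> and
    \<open>(1, True)\<close> nonzero, and these two elements already generate the group.\<close>
  moreover have "generate D_inf S = UNIV"
    by (rule generate_D_inf_UNIV[of _ 1]) (use nz \<nu> in \<open>auto simp: S_def Z_def hop_set_def\<close>)
  ultimately have "scalar_quantum_walk D_inf S Z"
    by (auto simp: scalar_quantum_walk_def walk) (auto simp: S_def)
  moreover have "coordination_number_two c S"
    unfolding coordination_number_two_iff[OF c] off[symmetric] by (auto simp: S_def)
  moreover have "has_symbol (coarse_graining c (walk_op D_inf S Z))
      (\<lambda>k\<in>{-pi..pi}. ?E \<odot> (rot \<theta> ** A_D \<nu> \<mu> s k ** rot \<theta>'))"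
    unfolding walk has_symbol_hop_iff[OF c off] hop_symbol_of_angles[symmetric]
    by (intro restrict_ext) (simp add: Z_def)
  ultimately have "(\<lambda>k\<in>{-pi..pi}. U ** (\<lambda>k\<in>{-pi..pi}. ?E \<odot> (rot \<theta> ** A_D \<nu> \<mu> s k ** rot \<theta>')) k ** adj U) \<in> W_CG"
    unfolding W_CG_def using U c by blast
  also have "(\<lambda>k\<in>{-pi..pi}. U ** (\<lambda>k\<in>{-pi..pi}. ?E \<odot> (rot \<theta> ** A_D \<nu> \<mu> s k ** rot \<theta>')) k ** adj U) =
     (\<lambda>k\<in>{-pi..pi}. ?E \<odot> (U ** rot \<theta> ** A_D \<nu> \<mu> s k ** rot \<theta>' ** adj U))"
    by (intro restrict_ext) (simp add: cscale_mult_left cscale_mult_right matrix_mul_assoc)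
  finally show ?thesis .
qed

theorem mainTheorem3:
  shows "W_CG =
    {(\<lambda>k\<in>{-pi..pi}. exp (\<i> * of_real \<eta>) \<odot>
        (U ** mexp ((\<i> * of_real \<theta>) \<odot> sigma_x) ** A_D \<nu> \<mu> s k **
         mexp ((\<i> * of_real \<theta>') \<odot> sigma_x) ** adj U))
     | (\<eta>::real) (U::complex^2^2) (\<theta>::real) (\<theta>'::real) (\<nu>::real) (\<mu>::real) (s::real).
       unitary_matrix U \<and>
       \<theta> \<in> {-pi/2<..<0} \<union> {0<..<pi/2} \<and>
       \<theta>' \<in> {-pi/2<..<0} \<union> {0<..<pi/2} \<and>
       \<nu> \<in> {0<..1} \<and> \<mu> \<in> {0..<1} \<and> \<nu>\<^sup>2 + \<mu>\<^sup>2 = 1 \<and> s \<in> {1, -1}}"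
  unfolding rot_def[symmetric]
proof (intro equalityI subsetI)
  fix f assume "f \<in> W_CG"
  then show "f \<in> {(\<lambda>k\<in>{-pi..pi}. exp (\<i> * of_real \<eta>) \<odot> (U ** rot \<theta> ** A_D \<nu> \<mu> s k ** rot \<theta>' ** adj U))
     | \<eta> U \<theta> \<theta>' \<nu> \<mu> s.
       unitary_matrix U \<and>
       \<theta> \<in> {-pi/2<..<0} \<union> {0<..<pi/2} \<and>
       \<theta>' \<in> {-pi/2<..<0} \<union> {0<..<pi/2} \<and>
       \<nu> \<in> {0<..1} \<and> \<mu> \<in> {0..<1} \<and> \<nu>\<^sup>2 + \<mu>\<^sup>2 = 1 \<and> s \<in> {1, -1}}"
    by (rule W_CG_subset) blast
qed (use W_CG_supset in force)

end
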